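(* Let $\{X^k,H^k,D^k\}$ be the sequence generated by the LEAD iteration with constant stepsize $\eta$ and parameters $\alpha,\gamma$, let $X^*$ be the optimal solution and $D^*=-\nabla F(X^* )$. Assume: (i) $W$ is a mixing matrix; (ii) the compression operator is unbiased and $C$-contracted with constant $C\ge 0$; (iii) the stochastic gradients are unbiased with variances bounded by $\sigma_i^2$, and $\sigma^2=\frac1n\sum_{i=1}^n\sigma_i^2$; (iv) each $f_i$ is $L$-smooth and $\mu$-strongly convex with $L\ge\mu>0$. Let $\beta:=\lambda_{\max}(I-W)$ and $a_1:=\frac{4(1+C)}{C\beta\gamma+2}$. For any constant stepsize $\eta\in(0,\frac{2}{\mu+L}]$, if the compression parameters $\alpha$ and $\gamma$ satisfy $$\gamma\in\Big(0,\min\Big\{\tfrac{2}{(3C+1)\beta},\ \tfrac{2\mu\eta(2-\mu\eta)}{[2-\mu\eta(2-\mu\eta)]C\beta}\Big\}\Big),\qquad \alpha\in\Big[\tfrac{C\beta\gamma}{2(1+C)},\ \tfrac1{a_1}\min\Big\{\tfrac{2-\beta\gamma}{4-\beta\gamma},\ \mu\eta(2-\mu\eta)\Big\}\Big],$$ then, in total expectation, $$\frac1n\mathbb E\,\mathcal L^{k+1}\le\rho\,\frac1n\mathbb E\,\mathcal L^k+\eta^2\sigma^2,$$ where $$\mathcal L^k:=(1-a_1\alpha)\|X^k-X^*\|^2+\frac{2\eta^2}{\gamma}\|D^k-D^*\|^2_{(I-W)^\dagger}+a_1\|H^k-X^*\|^2,$$ $$\rho:=\max\Big\{\frac{1-\mu\eta(2-\mu\eta)}{1-a_1\alpha},\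 1-\frac{\gamma}{2\lambda_{\max}((I-W)^\dagger)},\ 1-\alpha\Big\}<1.$$ The result holds for $C\to 0$.
   Context: Problem: $n$ agents minimize $f(x)=\frac1n\sum_{i=1}^n f_i(x)$ over $x\in\mathbb R^d$, with minimizer $x^*$. For $X\in\mathbb R^{n\times d}$ with rows $x_1^\top,\dots,x_n^\top$, $\nabla F(X)\in\mathbb R^{n\times d}$ is the matrix with $i$-th row $\nabla f_i(x_i)^\top$, and $\nabla F(X;\xi)$ is the matrix with $i$-th row the stochastic gradient $\nabla f_i(x_i;\xi_i)^\top$. $X^*\in\mathbb R^{n\times d}$ has all rows equal to $(x^* )^\top$. $\|A\|^2=\mathrm{tr}(A^\top A)$, $\|A\|_P^2=\mathrm{tr}(A^\top PA)$. $\dagger$ denotes the pseudoinverse and $\lambda_{\max}$ the largest eigenvalue. Mixing matrix: $W=[w_{ij}]\in\mathbb R^{n\times n}$ is symmetric, doubly stochastic and primitive, with $w_{ij}=0$ when agents $i,j$ are not connected in a connected undirected graph; hence $-1<\lambda_n(W)\le\dots\le\lambda_2(W)<\lambda_1(W)=1$ and $W\mathbf 1=\mathbf 1$. Compression: a random operator $Q:\mathbb R^d\to\mathbb R^d$ is unbiased and $C$-contracted if $\mathbb E Q(x)=x$ and $\mathbb E\|x-Q(x)\|_2^2\le C\|x\|_2^2$ for all $x$. $\mathrm{Compress}(A)$ applies $Q$ to each row of $A$, with fresh randomness at each iteration, so these properties hold conditionally on everything generated before the compression step. Stochastic gradients: $\mathbb E_\xi\nabla f_i(x;\xi)=\nabla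 f_i(x)$ and $\mathbb E_\xi\|\nabla f_i(x;\xi)-\nabla f_i(x)\|_2^2\le\sigma_i^2$ for all $x$ and $i$; samples are fresh at each iteration, so these hold conditionally on the past. $L$-smooth and $\mu$-strongly convex: for all $x,y$, $f_i(y)+\langle\nabla f_i(y),x-y\rangle+\frac\mu2\|x-y\|^2\le f_i(x)\le f_i(y)+\langle\nabla f_i(y),x-y\rangle+\frac L2\|x-y\|^2$. LEAD: given $X^0,H^1\in\mathbb R^{n\times d}$ and $D^1=(I-W)Z$ for any $Z\in\mathbb R^{n\times d}$, set $X^1=X^0-\eta\nabla F(X^0;\xi^0)$, and for $k=1,2,\dots$: $Y^k=X^k-\eta\nabla F(X^k;\xi^k)-\eta D^k$; $Q^k=\mathrm{Compress}(Y^k-H^k)$, $\hat Y^k=H^k+Q^k$; $H^{k+1}=(1-\alpha)H^k+\alpha\hat Y^k$; $D^{k+1}=D^k+\frac{\gamma}{2\eta}(I-W)\hat Y^k$; $X^{k+1}=X^k-\eta\nabla F(X^k;\xi^k)-\eta D^{k+1}$.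
   Formalization: The claim ρ<1 fails when a_1α=μη(2−μη) (first entry of the max equals 1) and when α=0 (possible only for C=0); the recursion is proved on the full closed ranges with ρ≤1, and ρ<1 is proved for all other admissible α. *)

theory Defs
  imports "HOL-Probability.Probability"
begin

section \<open>Matrices\<close>

definition eigenvalues :: "real^'n^'n \<Rightarrow> real set" where
  "eigenvalues A = {c. \<exists>v. v \<noteq> 0 \<and> A *v v = c *\<^sub>R v}"

(* Only used for symmetric matrices, whose set of real eigenvalues is finite and nonempty. *)
definition lambda_max :: "real^'n^'n \<Rightarrow> real" where
  "lambda_max A = Max (eigenvalues A)"

definition is_pseudoinverse :: "real^'n^'n \<Rightarrow> real^'n^'n \<Rightarrow> bool" where
  "is_pseudoinverse A B \<longleftrightarrow>
     A ** B ** A = A \<and> B ** A ** B = B \<and>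
     transpose (A ** B) = A ** B \<and> transpose (B ** A) = B ** A"

definition pseudoinverse :: "real^'n^'n \<Rightarrow> real^'n^'n" where
  "pseudoinverse A = (THE B. is_pseudoinverse A B)"

definition weighted_norm_sq :: "real^'n^'n \<Rightarrow> real^'d^'n \<Rightarrow> real" where
  "weighted_norm_sq P A = trace (transpose A ** P ** A)"

(* The library norm on real^'d^'n is the Frobenius norm. *)
lemma norm_sq_eq_trace:
  fixes A :: "real^'d^'n"
  shows "(norm A)\<^sup>2 = trace (transpose A ** A)"
proof -
  have "(norm A)\<^sup>2 = (\<Sum>i\<in>UNIV. \<Sum>j\<in>UNIV. A $ i $ j * A $ i $ j)"
    unfolding power2_norm_eq_inner by (simp add: inner_vec_def)
  also have "\<dots> = (\<Sum>j\<in>UNIV. \<Sum>i\<in>UNIV. A $ i $ j * A $ i $ j)"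
    by (rule sum.swap)
  finally show ?thesis
    by (simp add: trace_def matrix_matrix_mult_def transpose_def)
qed

section \<open>Mixing matrices\<close>

definition doubly_stochastic :: "real^'n^'n \<Rightarrow> bool" where
  "doubly_stochastic W \<longleftrightarrow>
     (\<forall>i j. 0 \<le> W $ i $ j) \<and>
     (\<forall>i. (\<Sum>j\<in>UNIV. W $ i $ j) = 1) \<and> (\<forall>j. (\<Sum>i\<in>UNIV. W $ i $ j) = 1)"

(* On real^'n^'n the operator ^ is not the matrix power, hence the iterated product. *)
definition primitive_matrix :: "real^'n^'n \<Rightarrow> bool" where
  "primitive_matrix W \<longleftrightarrow> (\<exists>m>0. \<forall>i j. 0 < (((**) W ^^ m) (mat 1)) $ i $ j)"

definition connected_graph :: "('n \<Rightarrow> 'n \<Rightarrow> bool) \<Rightarrow> bool" where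
  "connected_graph Adj \<longleftrightarrow> symp Adj \<and> (\<forall>i j. rtranclp Adj i j)"

definition mixing_matrix :: "('n \<Rightarrow> 'n \<Rightarrow> bool) \<Rightarrow> real^'n^'n \<Rightarrow> bool" where
  "mixing_matrix Adj W \<longleftrightarrow>
     transpose W = W \<and> doubly_stochastic W \<and> primitive_matrix W \<and>
     (\<forall>i j. i \<noteq> j \<and> \<not> Adj i j \<longrightarrow> W $ i $ j = 0)"

section \<open>Objective functions\<close>

definition smooth_strongly_convex ::
    "real \<Rightarrow> real \<Rightarrow> (real^'d \<Rightarrow> real) \<Rightarrow> (real^'d \<Rightarrow> real^'d) \<Rightarrow> bool" where
  "smooth_strongly_convex \<mu> L f g \<longleftrightarrow>
     (\<forall>x. GDERIV f x :> g x) \<and>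
     (\<forall>x y. f y + g y \<bullet> (x - y) + \<mu> / 2 * (norm (x - y))\<^sup>2 \<le> f x \<and>
            f x \<le> f y + g y \<bullet> (x - y) + L / 2 * (norm (x - y))\<^sup>2)"

definition grad_matrix :: "('n \<Rightarrow> real^'d \<Rightarrow> real^'d) \<Rightarrow> real^'d^'n \<Rightarrow> real^'d^'n" where
  "grad_matrix g X = (\<chi> i. g i (X $ i))"

definition stoch_grad_matrix ::
    "('n \<Rightarrow> real^'d \<Rightarrow> 'x \<Rightarrow> real^'d) \<Rightarrow> real^'d^'n \<Rightarrow> ('n \<Rightarrow> 'x) \<Rightarrow> real^'d^'n" where
  "stoch_grad_matrix G X s = (\<chi> i. G i (X $ i) (s i))"

definition consensus :: "real^'d \<Rightarrow> real^'d^'n" where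
  "consensus x = (\<chi> i. x)"

section \<open>Randomness\<close>

(* A random operator is a jointly measurable map of the argument and of a random seed;
   P is the distribution of the seed.  The explicit integrability requirements are needed
   because the Bochner integral of a non-integrable function is 0. *)

definition unbiased_stoch_grad ::
    "'x measure \<Rightarrow> (real^'d \<Rightarrow> 'x \<Rightarrow> real^'d) \<Rightarrow> (real^'d \<Rightarrow> real^'d) \<Rightarrow> real \<Rightarrow> bool" where
  "unbiased_stoch_grad P G g s \<longleftrightarrow>
     prob_space P \<and> case_prod G \<in> borel_measurable (borel \<Otimes>\<^sub>M P) \<and>
     (\<forall>x. integrable P (G x) \<and> (LINT z|P. G x z) = g x \<and>
          integrable P (\<lambda>z. (norm (G x z - g x))\<^sup>2) \<and>
          (LINT z|P. (norm (G x z - g x))\<^sup>2) \<le> s\<^sup>2)"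

definition unbiased_contracted ::
    "real \<Rightarrow> 's measure \<Rightarrow> (real^'d \<Rightarrow> 's \<Rightarrow> real^'d) \<Rightarrow> bool" where
  "unbiased_contracted C P Q \<longleftrightarrow>
     prob_space P \<and> case_prod Q \<in> borel_measurable (borel \<Otimes>\<^sub>M P) \<and>
     (\<forall>x. integrable P (Q x) \<and> (LINT z|P. Q x z) = x \<and>
          integrable P (\<lambda>z. (norm (x - Q x z))\<^sup>2) \<and>
          (LINT z|P. (norm (x - Q x z))\<^sup>2) \<le> C * (norm x)\<^sup>2)"

definition compress ::
    "(real^'d \<Rightarrow> 's \<Rightarrow> real^'d) \<Rightarrow> real^'d^'n \<Rightarrow> ('n \<Rightarrow> 's) \<Rightarrow> real^'d^'n" where
  "compress Q A s = (\<chi> i. Q (A $ i) (s i))"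

(* xi k w i is the sample of agent i at iteration k, and zeta k w i the seed with which row i is
   compressed at iteration k.  The random vectors xi 0, xi 1, zeta 1, xi 2, zeta 2, ... are
   mutually independent: each of them is independent of everything generated before it.
   Within one such vector, the components of different agents may be dependent.
   Independence is stated with indep_sets, on the generated sigma-algebras, because the two
   families take values in different types. *)
definition fresh_noise ::
    "'w measure \<Rightarrow> ('n \<Rightarrow> 'x measure) \<Rightarrow> 's measure \<Rightarrow>
     (nat \<Rightarrow> 'w \<Rightarrow> 'n \<Rightarrow> 'x) \<Rightarrow> (nat \<Rightarrow> 'w \<Rightarrow> 'n \<Rightarrow> 's) \<Rightarrow> bool" where
  "fresh_noise M PX PS \<xi> \<zeta> \<longleftrightarrow>
     (\<forall>k. \<xi> k \<in> measurable M (PiM UNIV PX) \<and> (\<forall>i. distr M (PX i) (\<lambda>w. \<xi> k w i) = PX i)) \<and>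
     (\<forall>k\<ge>1. \<zeta> k \<in> measurable M (PiM UNIV (\<lambda>_. PS)) \<and>
            (\<forall>i. distr M PS (\<lambda>w. \<zeta> k w i) = PS)) \<and>
     prob_space.indep_sets M
       (case_sum (\<lambda>k. sets (vimage_algebra (space M) (\<xi> k) (PiM UNIV PX)))
                 (\<lambda>k. sets (vimage_algebra (space M) (\<zeta> k) (PiM UNIV (\<lambda>_. PS)))))
       (UNIV <+> {1..})"

section \<open>The LEAD iteration\<close>

(* One sample path: SG k is the stochastic gradient map and Cmp k the compression map
   realised at iteration k. *)
definition lead_path ::
    "real^'n^'n \<Rightarrow> real \<Rightarrow> real \<Rightarrow> real \<Rightarrow>
     (nat \<Rightarrow> real^'d^'n \<Rightarrow> real^'d^'n) \<Rightarrow> (nat \<Rightarrow> real^'d^'n \<Rightarrow> real^'d^'n) \<Rightarrow>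
     real^'d^'n \<Rightarrow> real^'d^'n \<Rightarrow> real^'d^'n \<Rightarrow>
     (nat \<Rightarrow> real^'d^'n) \<Rightarrow> (nat \<Rightarrow> real^'d^'n) \<Rightarrow> (nat \<Rightarrow> real^'d^'n) \<Rightarrow> bool" where
  "lead_path W \<eta> \<alpha> \<gamma> SG Cmp X0 H1 Z X H D \<longleftrightarrow>
     X 0 = X0 \<and> H 1 = H1 \<and> D 1 = (mat 1 - W) ** Z \<and>
     X 1 = X0 - \<eta> *\<^sub>R SG 0 X0 \<and>
     (\<forall>k\<ge>1.
        let Y = X k - \<eta> *\<^sub>R SG k (X k) - \<eta> *\<^sub>R D k;
            Yhat = H k + Cmp k (Y - H k)
        in H (Suc k) = (1 - \<alpha>) *\<^sub>R H k + \<alpha> *\<^sub>R Yhat \<and>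
           D (Suc k) = D k + (\<gamma> / (2 * \<eta>)) *\<^sub>R ((mat 1 - W) ** Yhat) \<and>
           X (Suc k) = X k - \<eta> *\<^sub>R SG k (X k) - \<eta> *\<^sub>R D (Suc k))"

definition lead_lyapunov ::
    "real^'n^'n \<Rightarrow> real \<Rightarrow> real \<Rightarrow> real \<Rightarrow> real \<Rightarrow> real^'d^'n \<Rightarrow> real^'d^'n \<Rightarrow>
     real^'d^'n \<Rightarrow> real^'d^'n \<Rightarrow> real^'d^'n \<Rightarrow> real" where
  "lead_lyapunov W \<eta> \<alpha> \<gamma> a1 Xs Ds X H D =
     (1 - a1 * \<alpha>) * (norm (X - Xs))\<^sup>2
     + 2 * \<eta>\<^sup>2 / \<gamma> * weighted_norm_sq (pseudoinverse (mat 1 - W)) (D - Ds)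
     + a1 * (norm (H - Xs))\<^sup>2"

definition lead_rate :: "real^'n^'n \<Rightarrow> real \<Rightarrow> real \<Rightarrow> real \<Rightarrow> real \<Rightarrow> real \<Rightarrow> real" where
  "lead_rate W \<mu> \<eta> \<alpha> \<gamma> a1 =
     Max {(1 - \<mu> * \<eta> * (2 - \<mu> * \<eta>)) / (1 - a1 * \<alpha>),
          1 - \<gamma> / (2 * lambda_max (pseudoinverse (mat 1 - W))),
          1 - \<alpha>}"

(* Strict contraction is lost at the two extreme values of the compression parameter alpha. *)
lemma lead_rate_ge_1:
  assumes "\<alpha> = 0 \<or> a1 * \<alpha> = \<mu> * \<eta> * (2 - \<mu> * \<eta>) \<and> a1 * \<alpha> < 1"
  shows "1 \<le> lead_rate W \<mu> \<eta> \<alpha> \<gamma> a1"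
  using assms by (auto simp: lead_rate_def)

(* The second bound on gamma has C in its denominator and is +infinity for C = 0, where
   division by zero would yield the bound 0 instead. *)
definition gamma_bound :: "real \<Rightarrow> real \<Rightarrow> real \<Rightarrow> real \<Rightarrow> real" where
  "gamma_bound C \<beta> \<mu> \<eta> =
     (if C = 0 then 2 / ((3 * C + 1) * \<beta>)
      else min (2 / ((3 * C + 1) * \<beta>))
               (2 * \<mu> * \<eta> * (2 - \<mu> * \<eta>) / ((2 - \<mu> * \<eta> * (2 - \<mu> * \<eta>)) * C * \<beta>)))"

end

(* Write J for the averaging matrix, A = I - W, and e for the compression error, the difference
   between the estimate H^k + Q^k and Y^k.  Along every sample path the Lyapunov function obeys
   a one-step inequality whose error terms are linear in the gradient noise N and in e, or are
   quadratic.  The linear terms vanish in expectation, E|N|^2 is at most the sum of the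
   sigma_i^2, and E|e|^2 <= C E|Y^k - H^k|^2 is absorbed by - a_1 alpha (1 - alpha) |Y^k - H^k|^2,
   which comes from the convex combination that defines H^(k+1).
   The dual term decreases because D^k - D* has zero column sums, hence lies in the range of A,
   where A and its pseudoinverse (A + J)^(-1) - J are inverse to each other. *)

theory Submission
  imports Defs
begin

section \<open>Symmetric matrices and the spectrum of I - W\<close>

text \<open>The weights of the Lyapunov function come from a cancellation. The squared distance from
  Y^k to the optimum enters the one-step expansion with factor 1 - a_1 alpha through X^(k+1), with
  factor -1 through the dual term and with factor a_1 alpha through H^(k+1), so it drops out. What
  is left of Y^k is a form in A, nonpositive as soon as a_1 alpha <= (2 - beta gamma)/(4 - beta
  gamma); the other upper bound on alpha keeps the first entry of rho at most 1. Absorbing the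
  compression error becomes a polynomial inequality in beta gamma and (1 + C) alpha. The noise
  bounds hold for fixed arguments but are needed at random iterates. In place of conditional
  expectations, independence is turned into a product law, and Fubini's theorem integrates over the
  noise with the iterate frozen. This requires every iterate to be square integrable and measurable
  with respect to earlier noise. Agents may share randomness within an iteration, because squared
  Frobenius norms and inner products are sums over rows.\<close>

lemma matrix_mult_add_left: "(A + B) ** C = A ** C + B ** C" for A B :: "real^'n^'m"
  by (simp add: matrix_matrix_mult_def vec_eq_iff distrib_right sum.distrib)

lemma matrix_mult_diff_left: "(A - B) ** C = A ** C - B ** C" for A B :: "real^'n^'m"
  by (simp add: matrix_matrix_mult_def vec_eq_iff left_diff_distrib sum_subtractf)

lemma matrix_mult_diff_right: "A ** (B - C) = A ** B - A ** C" for A :: "real^'n^'m"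
  by (simp add: matrix_matrix_mult_def vec_eq_iff right_diff_distrib sum_subtractf)

section \<open>Eigenvalues and quadratic forms of symmetric matrices\<close>

lemma symmetric_matrix_inner:
  fixes A :: "real^'n^'n"
  assumes "transpose A = A"
  shows "x \<bullet> (A *v y) = (A *v x) \<bullet> y"
  by (metis assms dot_lmul_matrix transpose_matrix_vector)

text \<open>Eigenvectors of distinct eigenvalues are orthogonal, hence independent, and a
  finite-dimensional space holds only finitely many of them. Finiteness gives the \<open>Max\<close>
  in \<open>lambda_max\<close> its meaning.\<close>

lemma finite_eigenvalues_symmetric:
  fixes A :: "real^'n^'n"
  assumes "transpose A = A"
  shows "finite (eigenvalues A)"
proof -
  have "\<forall>c\<in>eigenvalues A. \<exists>v. v \<noteq> 0 \<and> A *v v = c *\<^sub>R v"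
    by (auto simp: eigenvalues_def)
  then obtain v where v: "\<And>c. c \<in> eigenvalues A \<Longrightarrow> v c \<noteq> 0 \<and> A *v v c = c *\<^sub>R v c"
    by metis
  have orth: "v c \<bullet> v c' = 0" if "c \<in> eigenvalues A" "c' \<in> eigenvalues A" "c \<noteq> c'" for c c'
    using symmetric_matrix_inner[OF assms, of "v c" "v c'"] v[OF that(1)] v[OF that(2)] that(3)
    by simp
  have "inj_on v (eigenvalues A)"
    by (rule inj_onI) (metis orth v inner_eq_zero_iff)
  moreover have "pairwise orthogonal (v ` eigenvalues A)"
    by (auto simp: pairwise_def orthogonal_def intro: orth)
  hence "independent (v ` eigenvalues A)"
    using v by (intro pairwise_orthogonal_independent) auto
  hence "finite (v ` eigenvalues A)"
    using independent_bound by blast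
  ultimately show ?thesis
    using finite_imageD by blast
qed

text \<open>A zero of a nonnegative quadratic form is a minimiser, so the gradient
  \<open>2 A v\<close> vanishes there: otherwise a short step along \<open>- A v\<close> would make
  the form negative.\<close>

lemma psd_form_zero_imp_kernel:
  fixes A :: "real^'n^'n"
  assumes sym: "transpose A = A" and psd: "\<And>x. 0 \<le> x \<bullet> (A *v x)" and v: "v \<bullet> (A *v v) = 0"
  shows "A *v v = 0"
proof (rule ccontr)
  assume ne: "A *v v \<noteq> 0"
  define w where "w = A *v v"
  define q where "q = w \<bullet> (A *v w)"
  have w: "w \<bullet> w > 0" using ne by (simp add: w_def)
  have q: "q \<ge> 0" unfolding q_def by (rule psd)
  \<comment> \<open>Short enough that the quadratic term \<open>t\<^sup>2 * q\<close> cannot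
    outweigh the linear gain; the \<open>+ 1\<close> keeps the denominator positive when
    \<open>q = 0\<close>.\<close>
  define t where "t = (w \<bullet> w) / (q + 1)"
  have t: "t > 0" using w q by (simp add: t_def)
  have "(v - t *\<^sub>R w) \<bullet> (A *v (v - t *\<^sub>R w)) = - (2 * t * (w \<bullet> w)) + t\<^sup>2 * q"
    using v symmetric_matrix_inner[OF sym, of v w]
    by (simp add: matrix_vector_mult_diff_distrib matrix_vector_mult_scaleR inner_diff_left
        inner_diff_right inner_commute q_def w_def power2_eq_square algebra_simps)
  hence "t * (2 * (w \<bullet> w)) \<le> t * (t * q)"
    using psd[of "v - t *\<^sub>R w"] by (simp add: power2_eq_square algebra_simps)
  hence "2 * (w \<bullet> w) \<le> t * q" using t by simp
  moreover have "t * q \<le> w \<bullet> w"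
    using w q by (simp add: t_def field_simps)
  ultimately show False using w by simp
qed

text \<open>By compactness the form attains a maximum \<open>c\<close> on the unit sphere. Then
  \<open>c I - A\<close> is positive semidefinite and its form vanishes at the maximiser, so the
  maximiser is an eigenvector for \<open>c\<close>, and no eigenvalue exceeds
  \<open>c\<close>.\<close>

lemma lambda_max_symmetric:
  fixes A :: "real^'n^'n"
  assumes sym: "transpose A = A"
  shows lambda_max_mem: "lambda_max A \<in> eigenvalues A"
    and rayleigh_le_lambda_max: "x \<bullet> (A *v x) \<le> lambda_max A * (norm x)\<^sup>2"
proof -
  have "\<exists>v\<in>sphere 0 1. \<forall>x\<in>sphere 0 1. x \<bullet> (A *v x) \<le> v \<bullet> (A *v v)"
  proof (rule continuous_attains_sup)
    have "axis undefined 1 \<in> sphere (0 :: real^'n) 1" by simp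
    thus "sphere (0 :: real^'n) 1 \<noteq> {}" by blast
    show "continuous_on (sphere 0 1) (\<lambda>x. x \<bullet> (A *v x))"
      by (intro continuous_intros linear_continuous_on matrix_vector_mul_bounded_linear)
  qed simp
  then obtain v where nv: "norm v = 1"
    and max: "\<And>x. norm x = 1 \<Longrightarrow> x \<bullet> (A *v x) \<le> v \<bullet> (A *v v)"
    by auto
  define c where "c = v \<bullet> (A *v v)"
  have le: "x \<bullet> (A *v x) \<le> c * (norm x)\<^sup>2" for x
  proof (cases "x = 0")
    case False
    have "(x /\<^sub>R norm x) \<bullet> (A *v (x /\<^sub>R norm x)) \<le> c"
      unfolding c_def using False by (intro max) simp
    thus ?thesis using False
      by (simp add: matrix_vector_mult_scaleR field_simps power2_eq_square)
  qed simp
  define E where "E = c *\<^sub>R mat 1 - A"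
  have E: "E *v x = c *\<^sub>R x - A *v x" for x
    by (simp add: E_def matrix_vector_mult_diff_rdistrib scaleR_matrix_vector_assoc[symmetric])
  have "E *v v = 0"
  proof (rule psd_form_zero_imp_kernel)
    show "transpose E = E"
      using sym by (simp add: E_def transpose_def vec_eq_iff mat_def eq_commute)
    show "0 \<le> x \<bullet> (E *v x)" for x
      using le[of x] by (simp add: E inner_diff_right power2_norm_eq_inner)
    show "v \<bullet> (E *v v) = 0"
      using nv by (simp add: E inner_diff_right c_def flip: power2_norm_eq_inner)
  qed
  hence "A *v v = c *\<^sub>R v" by (simp add: E)
  hence c: "c \<in> eigenvalues A"
    using nv unfolding eigenvalues_def by (intro CollectI exI[of _ v]) auto
  have "c' \<le> c" if "c' \<in> eigenvalues A" for c'
  proof -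
    obtain u where u: "u \<noteq> 0" "A *v u = c' *\<^sub>R u" using \<open>c' \<in> _\<close> by (auto simp: eigenvalues_def)
    have "c' * (norm u)\<^sup>2 \<le> c * (norm u)\<^sup>2"
      using le[of u] u by (simp add: power2_norm_eq_inner)
    thus ?thesis using u(1) by simp
  qed
  hence "lambda_max A = c"
    unfolding lambda_max_def using finite_eigenvalues_symmetric[OF sym] c by (intro Max_eqI) auto
  thus "lambda_max A \<in> eigenvalues A" "x \<bullet> (A *v x) \<le> lambda_max A * (norm x)\<^sup>2"
    using c le by auto
qed

text \<open>The form at \<open>x - t *\<^sub>R (A *v x)\<close> is nonnegative; the choice
  \<open>t = 1 / lambda_max A\<close> optimises the resulting quadratic bound in
  \<open>t\<close>.\<close>

lemma norm_mult_sq_le_form: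
  fixes A :: "real^'n^'n"
  assumes sym: "transpose A = A" and psd: "\<And>x. 0 \<le> x \<bullet> (A *v x)" and pos: "lambda_max A > 0"
  shows "(norm (A *v x))\<^sup>2 \<le> lambda_max A * (x \<bullet> (A *v x))"
proof -
  define t w where "t = 1 / lambda_max A" and "w = A *v x"
  have "0 \<le> (x - t *\<^sub>R w) \<bullet> (A *v (x - t *\<^sub>R w))" by (rule psd)
  also have "\<dots> = x \<bullet> (A *v x) - 2 * t * (norm w)\<^sup>2 + t\<^sup>2 * (w \<bullet> (A *v w))"
    using symmetric_matrix_inner[OF sym, of x w] unfolding power2_norm_eq_inner
    by (simp add: matrix_vector_mult_diff_distrib matrix_vector_mult_scaleR inner_diff_left
        inner_diff_right inner_commute w_def power2_eq_square algebra_simps)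
  also have "\<dots> \<le> x \<bullet> (A *v x) - 2 * t * (norm w)\<^sup>2 + t\<^sup>2 * (lambda_max A * (norm w)\<^sup>2)"
    by (intro add_left_mono mult_left_mono rayleigh_le_lambda_max sym) simp
  also have "\<dots> = x \<bullet> (A *v x) - (norm w)\<^sup>2 / lambda_max A"
    using pos by (simp add: t_def field_simps power2_eq_square)
  finally show ?thesis using pos by (simp add: w_def field_simps)
qed

section \<open>Moore-Penrose inverses\<close>

text \<open>Transposing \<open>A B = (A C) (A B)\<close> and using the symmetry of both products
  gives \<open>A B = A C\<close>, and likewise \<open>B A = C A\<close>; hence
  \<open>B = B A B = C A C = C\<close>. This justifies the \<open>THE\<close> in
  \<open>pseudoinverse\<close>.\<close>

lemma pseudoinverse_unique:
  assumes "is_pseudoinverse A B" "is_pseudoinverse A C"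
  shows "B = C"
proof -
  have B: "A ** B ** A = A" "B ** A ** B = B" "transpose (A ** B) = A ** B" "transpose (B ** A) = B ** A"
    and C: "A ** C ** A = A" "C ** A ** C = C" "transpose (A ** C) = A ** C" "transpose (C ** A) = C ** A"
    using assms by (auto simp: is_pseudoinverse_def)
  have "A ** B = (A ** C) ** (A ** B)"
    by (simp add: matrix_mul_assoc C(1))
  hence "transpose (A ** B) = transpose (A ** B) ** transpose (A ** C)"
    by (metis matrix_transpose_mul)
  hence "A ** B = (A ** B ** A) ** C" unfolding B(3) C(3) by (simp add: matrix_mul_assoc)
  hence AB: "A ** B = A ** C" by (simp add: B(1))
  have "B ** A = (B ** A) ** (C ** A)"
    by (simp add: C(1) flip: matrix_mul_assoc) (simp add: C(1) matrix_mul_assoc)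
  hence "transpose (B ** A) = transpose (C ** A) ** transpose (B ** A)"
    by (metis matrix_transpose_mul)
  hence "B ** A = C ** (A ** B ** A)" unfolding B(4) C(4) by (simp add: matrix_mul_assoc)
  hence BA: "B ** A = C ** A" by (simp add: B(1))
  have "B = B ** (A ** B)" by (simp add: matrix_mul_assoc B(2))
  also have "\<dots> = C ** A ** C" by (simp add: AB matrix_mul_assoc BA)
  finally show ?thesis by (simp add: C(2))
qed

lemma pseudoinverse_eqI: "is_pseudoinverse A B \<Longrightarrow> pseudoinverse A = B"
  unfolding pseudoinverse_def by (rule the_equality) (auto intro: pseudoinverse_unique)

text \<open>A matrix acts on each column separately, so the forms and norms of the iterates are sums
  over columns; this is how every bound for vectors carries over to matrices.\<close>

lemma inner_eq_sum_columns:
  fixes X Y :: "real^'d^'n"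
  shows "X \<bullet> Y = (\<Sum>j\<in>UNIV. column j X \<bullet> column j Y)"
  unfolding inner_vec_def column_def by simp (rule sum.swap)

lemma column_matrix_mult: "column j (A ** X) = A *v column j X"
  by (simp add: column_def matrix_matrix_mult_def matrix_vector_mult_def vec_eq_iff)

lemma norm_sq_eq_sum_columns:
  fixes X :: "real^'d^'n"
  shows "(norm X)\<^sup>2 = (\<Sum>j\<in>UNIV. (norm (column j X))\<^sup>2)"
  by (simp add: power2_norm_eq_inner inner_eq_sum_columns)

lemma weighted_norm_sq_eq_inner:
  fixes X :: "real^'d^'n"
  shows "weighted_norm_sq P X = X \<bullet> (P ** X)"
proof -
  have "weighted_norm_sq P X = (\<Sum>j\<in>UNIV. \<Sum>i\<in>UNIV. X $ i $ j * (P ** X) $ i $ j)"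
    unfolding weighted_norm_sq_def matrix_mul_assoc[symmetric]
    by (simp add: trace_def transpose_def matrix_matrix_mult_def[of _ "P ** X"])
  also have "\<dots> = (\<Sum>i\<in>UNIV. \<Sum>j\<in>UNIV. X $ i $ j * (P ** X) $ i $ j)"
    by (rule sum.swap)
  finally show ?thesis by (simp add: inner_vec_def)
qed

lemma symmetric_matrix_inner_matrix:
  fixes A :: "real^'n^'n" and X Y :: "real^'d^'n"
  assumes "transpose A = A"
  shows "X \<bullet> (A ** Y) = (A ** X) \<bullet> Y"
  by (simp add: inner_eq_sum_columns column_matrix_mult symmetric_matrix_inner[OF assms])

definition average_matrix :: "real^'n^'n" where
  "average_matrix = (\<chi> i j. 1 / real CARD('n))"

lemma average_matrix_vec: "average_matrix *v v = (\<chi> i. (\<Sum>j\<in>UNIV. v $ j) / real CARD('n))"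
  for v :: "real^'n"
  by (simp add: average_matrix_def matrix_vector_mult_def sum_divide_distrib)

lemma average_matrix_mult_nth:
  fixes X :: "real^'d^'n"
  shows "(average_matrix ** X) $ i = (1 / real CARD('n)) *\<^sub>R (\<Sum>j\<in>UNIV. X $ j)"
  by (simp add: average_matrix_def matrix_matrix_mult_def vec_eq_iff sum_divide_distrib)

lemma average_matrix_idem: "average_matrix ** average_matrix = average_matrix"
  by (simp add: average_matrix_def matrix_matrix_mult_def vec_eq_iff)

lemma transpose_average_matrix: "transpose average_matrix = average_matrix"
  by (simp add: average_matrix_def transpose_def vec_eq_iff)

section \<open>The matrix \<open>I - W\<close> and its pseudoinverse\<close>

locale mixing =
  fixes Adj :: "'n::finite \<Rightarrow> 'n \<Rightarrow> bool" and W :: "real^'n^'n"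
  assumes mixing: "mixing_matrix Adj W"
begin

definition "A = mat 1 - W"

lemma W_nonneg: "0 \<le> W $ i $ j" and W_row: "(\<Sum>j\<in>UNIV. W $ i $ j) = 1"
  and W_col: "(\<Sum>i\<in>UNIV. W $ i $ j) = 1"
  using mixing by (auto simp: mixing_matrix_def doubly_stochastic_def)

lemma transpose_W: "transpose W = W"
  using mixing by (auto simp: mixing_matrix_def)

lemma sym_A: "transpose A = A"
proof -
  have "W $ i $ j = W $ j $ i" for i j
    using transpose_W by (simp add: transpose_def vec_eq_iff)
  thus ?thesis by (simp add: A_def transpose_def vec_eq_iff mat_def)
qed

lemma A_vec: "A *v x = x - W *v x"
  by (simp add: A_def matrix_vector_mult_diff_rdistrib)

text \<open>The inequality \<open>2 x_i x_j \<le> x_i\<^sup>2 + x_j\<^sup>2\<close>, weighted by the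
  nonnegative entries of \<open>W\<close> and summed with unit row and column sums, gives
  \<open>x \<bullet> W x \<le> x \<bullet> x\<close>.\<close>

lemma psd_A: "0 \<le> x \<bullet> (A *v x)"
proof -
  have "x \<bullet> (W *v x) = (\<Sum>i\<in>UNIV. \<Sum>j\<in>UNIV. W $ i $ j * (x $ i * x $ j))"
    by (simp add: inner_vec_def matrix_vector_mult_def sum_distrib_left mult_ac)
  also have "\<dots> \<le> (\<Sum>i\<in>UNIV. \<Sum>j\<in>UNIV. W $ i $ j * (((x $ i)\<^sup>2 + (x $ j)\<^sup>2) / 2))"
  proof (intro sum_mono mult_left_mono W_nonneg)
    show "x $ i * x $ j \<le> ((x $ i)\<^sup>2 + (x $ j)\<^sup>2) / 2" for i j
      using sum_squares_bound[of "x $ i" "x $ j"] by simp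
  qed
  also have "\<dots> = (\<Sum>i\<in>UNIV. (\<Sum>j\<in>UNIV. W $ i $ j) * (x $ i)\<^sup>2 / 2)
      + (\<Sum>i\<in>UNIV. \<Sum>j\<in>UNIV. W $ i $ j * (x $ j)\<^sup>2 / 2)"
    by (simp add: sum.distrib[symmetric] sum_distrib_right sum_divide_distrib distrib_left add_divide_distrib)
  also have "(\<Sum>i\<in>UNIV. \<Sum>j\<in>UNIV. W $ i $ j * (x $ j)\<^sup>2 / 2)
      = (\<Sum>j\<in>UNIV. (\<Sum>i\<in>UNIV. W $ i $ j) * (x $ j)\<^sup>2 / 2)"
    by (subst sum.swap) (simp add: sum_distrib_right sum_divide_distrib)
  also have "(\<Sum>i\<in>UNIV. (\<Sum>j\<in>UNIV. W $ i $ j) * (x $ i)\<^sup>2 / 2)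
      + (\<Sum>j\<in>UNIV. (\<Sum>i\<in>UNIV. W $ i $ j) * (x $ j)\<^sup>2 / 2) = x \<bullet> x"
    by (simp add: W_row W_col inner_vec_def power2_eq_square sum.distrib[symmetric])
  finally show ?thesis by (simp add: A_vec inner_diff_right)
qed

(* Maximum principle: some power of W has only positive entries, so a vector fixed by W is
   constant, because its largest entry is a weighted mean of all its entries. *)
lemma kernel_A:
  assumes "A *v v = 0"
  shows "v $ i = v $ j"
proof -
  have Wv: "W *v v = v" using assms by (simp add: A_vec)
  have W1: "W *v 1 = 1" by (simp add: matrix_vector_mult_def vec_eq_iff W_row)
  obtain m where m: "\<And>i j. 0 < (((**) W ^^ m) (mat 1)) $ i $ j"
    using mixing by (auto simp: mixing_matrix_def primitive_matrix_def)
  define P where "P = ((**) W ^^ m) (mat 1)"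
  have fixed: "((**) W ^^ m) (mat 1) *v u = u" if "W *v u = u" for u m
    by (induction m) (simp_all add: that flip: matrix_vector_mul_assoc)
  have Pv: "P *v v = v" and P1: "P *v 1 = 1"
    unfolding P_def by (rule fixed, fact)+
  have row: "(\<Sum>j\<in>UNIV. P $ i $ j) = 1" for i
    using arg_cong[OF P1, of "\<lambda>x. x $ i"] by (simp add: matrix_vector_mult_def)
  have "Max (range (($) v)) \<in> range (($) v)" by (rule Max_in) auto
  then obtain i where i: "Max (range (($) v)) = v $ i" by (rule imageE)
  have max: "v $ j \<le> v $ i" for j unfolding i[symmetric] by (rule Max_ge) auto
  have "(\<Sum>j\<in>UNIV. P $ i $ j * (v $ i - v $ j)) = (\<Sum>j\<in>UNIV. P $ i $ j) * v $ i - (P *v v) $ i"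
    by (simp add: right_diff_distrib sum_subtractf sum_distrib_right matrix_vector_mult_def)
  also have "\<dots> = 0" by (simp add: row Pv)
  finally have "P $ i $ j * (v $ i - v $ j) = 0" for j
    using m max by (subst (asm) sum_nonneg_eq_0_iff) (auto simp: P_def less_imp_le)
  hence "v $ j = v $ i" for j
    using m[of i j] by (simp add: P_def) (metis less_irrefl)
  thus ?thesis by metis
qed

lemma average_A: "average_matrix ** A = 0" and A_average: "A ** average_matrix = 0"
proof -
  have "average_matrix ** W = average_matrix" "W ** average_matrix = average_matrix"
    by (simp_all add: average_matrix_def matrix_matrix_mult_def vec_eq_iff W_row W_col
        flip: sum_divide_distrib)
  thus "average_matrix ** A = 0" "A ** average_matrix = 0"
    by (simp_all add: A_def matrix_mult_diff_right matrix_mult_diff_left)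
qed

lemma A_consensus: "A ** consensus x = 0"
proof -
  have "W ** consensus x = consensus x"
    by (simp add: consensus_def matrix_matrix_mult_def vec_eq_iff W_row flip: sum_distrib_right)
  thus ?thesis by (simp add: A_def matrix_mult_diff_left)
qed

definition "B = pseudoinverse A"

(* The pseudoinverse is the inverse of A + J minus J, J the projection on the constants. *)
lemma pseudoinverse_A:
  shows A_B: "A ** B = mat 1 - average_matrix" and B_A: "B ** A = mat 1 - average_matrix"
    and B_A_B: "B ** A ** B = B" and sym_B: "transpose B = B"
proof -
  let ?J = "average_matrix :: real^'n^'n"
  \<comment> \<open>\<open>J\<close> annihilates the \<open>A\<close> part, so
    \<open>J x = 0\<close> and then \<open>A x = 0\<close>: \<open>x\<close> is a constant vector
    with zero sum.\<close>
  have "x = 0" if x: "(A + ?J) *v x = 0" for x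
  proof -
    have "?J *v ((A + ?J) *v x) = ?J *v x"
      by (simp add: matrix_vector_mul_assoc matrix_add_ldistrib average_A average_matrix_idem)
    hence J: "?J *v x = 0" using x by simp
    hence "A *v x = 0" using x by (simp add: matrix_vector_mult_add_rdistrib)
    hence eq: "x $ j = x $ i" for i j using kernel_A by blast
    show "x = 0"
    proof (subst vec_eq_iff, rule allI)
      fix i
      have "(\<Sum>j\<in>UNIV. x $ j) = (\<Sum>j\<in>(UNIV::'n set). x $ i)" by (intro sum.cong eq refl)
      moreover have "(\<Sum>j\<in>UNIV. x $ j) = 0"
        using J by (simp add: average_matrix_vec vec_eq_iff)
      ultimately show "x $ i = 0 $ i" by simp
    qed
  qed
  then obtain R where RL: "R ** (A + ?J) = mat 1"
    using matrix_left_invertible_ker by blast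
  hence LR: "(A + ?J) ** R = mat 1" using matrix_left_right_inverse by blast
  have "transpose (A + ?J) = A + ?J"
    using sym_A transpose_average_matrix by (simp add: transpose_def vec_eq_iff)
  hence RtL: "transpose R ** (A + ?J) = mat 1"
    using arg_cong[OF LR, of transpose] by (simp add: matrix_transpose_mul transpose_mat)
  have "transpose R = transpose R ** ((A + ?J) ** R)" by (simp add: LR)
  also have "\<dots> = R" unfolding matrix_mul_assoc RtL by simp
  finally have symR: "transpose R = R" .
  \<comment> \<open>Multiplication by \<open>A + J\<close> from either side fixes \<open>J\<close>,
    therefore so does multiplication by its inverse \<open>R\<close>; this turns the inverse
    equations into \<open>A R = R A = I - J\<close>.\<close>
  have "(A + ?J) ** ?J = ?J" "?J ** (A + ?J) = ?J"
    by (simp_all add: matrix_add_ldistrib matrix_mult_add_left average_A A_average average_matrix_idem)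
  hence "R ** (A + ?J) ** ?J = R ** ?J" "?J ** ((A + ?J) ** R) = ?J ** R"
    by (simp_all add: matrix_mul_assoc) (simp add: flip: matrix_mul_assoc)
  hence RJ: "R ** ?J = ?J" and JR: "?J ** R = ?J" by (simp_all add: RL LR)
  have AR: "A ** R = mat 1 - ?J" and RA: "R ** A = mat 1 - ?J"
    using LR RL by (simp_all add: matrix_add_ldistrib matrix_mult_add_left RJ JR eq_diff_eq)
  define B' where "B' = R - ?J"
  have AB': "A ** B' = mat 1 - ?J" and BA': "B' ** A = mat 1 - ?J"
    by (simp_all add: B'_def matrix_mult_diff_right matrix_mult_diff_left AR RA average_A A_average)
  have BAB': "B' ** A ** B' = B'"
    by (simp add: BA' matrix_mult_diff_left) (simp add: B'_def matrix_mult_diff_right JR average_matrix_idem)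
  have sym1: "transpose (mat 1 - ?J) = mat 1 - ?J"
    by (simp add: transpose_def mat_def average_matrix_def vec_eq_iff)
  have "is_pseudoinverse A B'"
    unfolding is_pseudoinverse_def
    by (simp add: AB' BAB' sym1) (simp add: BA' sym1 matrix_mult_diff_left average_A)
  hence "B = B'" unfolding B_def by (rule pseudoinverse_eqI)
  moreover have "transpose B' = B'"
    using symR transpose_average_matrix by (simp add: B'_def transpose_def vec_eq_iff)
  ultimately show "A ** B = mat 1 - ?J" "B ** A = mat 1 - ?J" "B ** A ** B = B" "transpose B = B"
    using AB' BA' BAB' by simp_all
qed

lemma psd_A_matrix: "0 \<le> X \<bullet> (A ** X)" for X :: "real^'d^'n"
  by (simp add: inner_eq_sum_columns column_matrix_mult sum_nonneg psd_A)

text \<open>\<open>B = B A B\<close> turns the form of \<open>B\<close> at \<open>X\<close> into the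
  form of \<open>A\<close> at \<open>B X\<close>.\<close>

lemma psd_B_matrix: "0 \<le> X \<bullet> (B ** X)" for X :: "real^'d^'n"
proof -
  have "X \<bullet> (B ** X) = X \<bullet> (B ** (A ** (B ** X)))" by (simp add: matrix_mul_assoc B_A_B)
  also have "\<dots> = (B ** X) \<bullet> (A ** (B ** X))" by (rule symmetric_matrix_inner_matrix[OF sym_B])
  finally show ?thesis by (simp add: psd_A_matrix)
qed

lemma form_A_le: "X \<bullet> (A ** X) \<le> lambda_max A * (norm X)\<^sup>2" for X :: "real^'d^'n"
  by (simp add: inner_eq_sum_columns column_matrix_mult norm_sq_eq_sum_columns sum_distrib_left
      sum_mono rayleigh_le_lambda_max[OF sym_A])

lemma form_B_le: "X \<bullet> (B ** X) \<le> lambda_max B * (norm X)\<^sup>2" for X :: "real^'d^'n"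
  by (simp add: inner_eq_sum_columns column_matrix_mult norm_sq_eq_sum_columns sum_distrib_left
      sum_mono rayleigh_le_lambda_max[OF sym_B])

lemma norm_A_sq_le:
  fixes X :: "real^'d^'n"
  assumes "lambda_max A > 0"
  shows "(norm (A ** X))\<^sup>2 \<le> lambda_max A * (X \<bullet> (A ** X))"
  by (simp add: inner_eq_sum_columns column_matrix_mult norm_sq_eq_sum_columns sum_distrib_left
      sum_mono norm_mult_sq_le_form[OF sym_A psd_A assms])

lemma lambda_max_A_nonneg: "0 \<le> lambda_max A"
proof -
  obtain v where "v \<noteq> 0" "A *v v = lambda_max A *\<^sub>R v"
    using lambda_max_mem[OF sym_A] by (auto simp: eigenvalues_def)
  moreover from this have "0 < v \<bullet> v" by simp
  ultimately show ?thesis using psd_A[of v] by (simp add: zero_le_mult_iff del: inner_gt_zero_iff)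
qed

text \<open>An eigenvector \<open>v\<close> for the positive eigenvalue \<open>lambda_max A\<close>
  is annihilated by \<open>J\<close>, since \<open>J A = 0\<close>. So \<open>B A v = v\<close>,
  which makes \<open>v\<close> an eigenvector of \<open>B\<close> with eigenvalue
  \<open>1 / lambda_max A\<close>. The rate divides by \<open>lambda_max B\<close>, hence the
  interest in its sign.\<close>

lemma lambda_max_B_pos:
  assumes pos: "lambda_max A > 0"
  shows "lambda_max B > 0"
proof -
  obtain v where v: "v \<noteq> 0" and Av: "A *v v = lambda_max A *\<^sub>R v"
    using lambda_max_mem[OF sym_A] by (auto simp: eigenvalues_def)
  have "lambda_max A *\<^sub>R (average_matrix *v v) = (average_matrix ** A) *v v"
    by (simp add: Av matrix_vector_mult_scaleR flip: matrix_vector_mul_assoc)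
  hence J: "average_matrix *v v = 0" using pos by (simp add: average_A)
  have "lambda_max A *\<^sub>R (B *v v) = (B ** A) *v v"
    by (simp add: Av matrix_vector_mult_scaleR flip: matrix_vector_mul_assoc)
  hence eq: "lambda_max A *\<^sub>R (B *v v) = v"
    by (simp add: B_A matrix_vector_mult_diff_rdistrib J)
  have "0 < v \<bullet> (lambda_max A *\<^sub>R (B *v v))" unfolding eq using v by simp
  hence "0 < v \<bullet> (B *v v)" using pos by (simp add: zero_less_mult_iff)
  also have "\<dots> \<le> lambda_max B * (norm v)\<^sup>2" by (rule rayleigh_le_lambda_max[OF sym_B])
  finally show ?thesis using v by (simp add: zero_less_mult_iff)
qed

end

section \<open>Gradients and the descent inequality\<close>

text \<open>Subtracting \<mu>/2 times the squared norm leaves a convex, (L - \<mu>)-smooth function;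
  \<open>\<Delta>\<close> is the difference of its gradients. Co-coercivity and monotonicity of
  \<open>\<Delta>\<close>, rewritten for \<open>g\<close>, are the two claims.\<close>

lemma gradient_diff_bounds:
  fixes f :: "real^'d \<Rightarrow> real"
  assumes f: "smooth_strongly_convex \<mu> L f g" and "\<mu> \<le> L"
  shows gradient_cocoercive:
      "(norm (g x - g y))\<^sup>2 + \<mu> * L * (norm (x - y))\<^sup>2 \<le> (\<mu> + L) * ((g x - g y) \<bullet> (x - y))"
    and gradient_strongly_monotone: "\<mu> * (norm (x - y))\<^sup>2 \<le> (g x - g y) \<bullet> (x - y)"
proof -
  have lo: "f y + g y \<bullet> (x - y) + \<mu> / 2 * ((x - y) \<bullet> (x - y)) \<le> f x"
    and hi: "f x \<le> f y + g y \<bullet> (x - y) + L / 2 * ((x - y) \<bullet> (x - y))" for x y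
    using f by (auto simp: smooth_strongly_convex_def power2_norm_eq_inner)
  define \<Delta> where "\<Delta> = (g x - g y) - \<mu> *\<^sub>R (x - y)"
  define \<delta> where "\<delta> = x - y"
  \<comment> \<open>Upper and lower quadratic bounds are compared at
    \<open>x - t *\<^sub>R \<Delta>\<close> and \<open>y + t *\<^sub>R \<Delta>\<close> and added.
    The step \<open>t\<close> stays free: \<open>1 / (L - \<mu>)\<close> gives co-coercivity,
    \<open>0\<close> gives monotonicity, and large \<open>t\<close> forces
    \<open>\<Delta> = 0\<close> when \<open>L = \<mu>\<close>.\<close>
  have key: "(2 * t - (L - \<mu>) * t\<^sup>2) * (\<Delta> \<bullet> \<Delta>) \<le> \<Delta> \<bullet> \<delta>" for t
  proof -
    have e: "x - t *\<^sub>R \<Delta> - y = \<delta> - t *\<^sub>R \<Delta>" "x - t *\<^sub>R \<Delta> - x = - (t *\<^sub>R \<Delta>)"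
      "y + t *\<^sub>R \<Delta> - x = - (\<delta> - t *\<^sub>R \<Delta>)" "y + t *\<^sub>R \<Delta> - y = t *\<^sub>R \<Delta>"
      by (simp_all add: \<delta>_def)
    have gx: "g x = g y + \<Delta> + \<mu> *\<^sub>R \<delta>" by (simp add: \<Delta>_def \<delta>_def)
    show ?thesis
      using lo[of y "x - t *\<^sub>R \<Delta>"] hi[of "x - t *\<^sub>R \<Delta>" x]
        lo[of x "y + t *\<^sub>R \<Delta>"] hi[of "y + t *\<^sub>R \<Delta>" y] unfolding e gx
      by (simp add: inner_diff_left inner_diff_right inner_add_left inner_add_right inner_commute
          power2_eq_square algebra_simps)
  qed
  have "\<Delta> \<bullet> \<Delta> \<le> (L - \<mu>) * (\<Delta> \<bullet> \<delta>) \<and> 0 \<le> \<Delta> \<bullet> \<delta>"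
  proof (cases "L = \<mu>")
    case True
    have "\<Delta> \<bullet> \<Delta> = 0"
    proof (rule ccontr)
      assume "\<Delta> \<bullet> \<Delta> \<noteq> 0"
      thus False using key[of "(\<Delta> \<bullet> \<delta> + 1) / (\<Delta> \<bullet> \<Delta>)"] key[of 0] True by simp
    qed
    thus ?thesis using True by simp
  next
    case False
    hence pos: "L - \<mu> > 0" using \<open>\<mu> \<le> L\<close> by simp
    have "(1 / (L - \<mu>)) * (\<Delta> \<bullet> \<Delta>) \<le> \<Delta> \<bullet> \<delta>"
      using key[of "1 / (L - \<mu>)"] pos by (simp add: power2_eq_square)
    thus ?thesis using pos key[of 0] by (simp add: field_simps)
  qed
  moreover have "g x - g y = \<Delta> + \<mu> *\<^sub>R \<delta>" by (simp add: \<Delta>_def \<delta>_def)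
  ultimately show "(norm (g x - g y))\<^sup>2 + \<mu> * L * (norm (x - y))\<^sup>2 \<le> (\<mu> + L) * ((g x - g y) \<bullet> (x - y))"
    and "\<mu> * (norm (x - y))\<^sup>2 \<le> (g x - g y) \<bullet> (x - y)"
    unfolding power2_norm_eq_inner \<delta>_def[symmetric]
    by (simp_all add: inner_add_left inner_add_right inner_commute algebra_simps)
qed

text \<open>Co-coercivity replaces the squared gradient difference. The bound on
  \<open>\<eta>\<close> makes the remaining coefficient \<open>2 - \<eta> * (\<mu> + L)\<close>
  nonnegative, so strong monotonicity applies to what is left. The factor equals
  \<open>(1 - \<mu> * \<eta>)\<^sup>2\<close>.\<close>

lemma gradient_step_contraction:
  fixes f :: "real^'d \<Rightarrow> real"
  assumes f: "smooth_strongly_convex \<mu> L f g" and \<mu>: "0 < \<mu>" "\<mu> \<le> L"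
    and \<eta>: "0 < \<eta>" "\<eta> \<le> 2 / (\<mu> + L)"
  shows "(norm (x - y - \<eta> *\<^sub>R (g x - g y)))\<^sup>2 \<le> (1 - \<mu> * \<eta> * (2 - \<mu> * \<eta>)) * (norm (x - y))\<^sup>2"
proof -
  define N I G where "N = (norm (x - y))\<^sup>2" and "I = (g x - g y) \<bullet> (x - y)" and "G = (norm (g x - g y))\<^sup>2"
  have co: "G + \<mu> * L * N \<le> (\<mu> + L) * I" and mono: "\<mu> * N \<le> I"
    using gradient_diff_bounds[OF f \<mu>(2), of x y] by (simp_all add: N_def I_def G_def)
  have s: "\<eta> * (\<mu> + L) \<le> 2" using \<eta> \<mu> by (simp add: field_simps)
  have "(norm (x - y - \<eta> *\<^sub>R (g x - g y)))\<^sup>2 = N - 2 * \<eta> * I + \<eta>\<^sup>2 * G"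
    unfolding N_def I_def G_def power2_norm_eq_inner
    by (simp add: inner_diff_left inner_diff_right inner_commute power2_eq_square algebra_simps)
  also have "\<dots> \<le> N - 2 * \<eta> * I + \<eta>\<^sup>2 * ((\<mu> + L) * I - \<mu> * L * N)"
    using co by (intro add_left_mono mult_left_mono) auto
  also have "\<dots> = N - \<eta>\<^sup>2 * \<mu> * L * N - \<eta> * ((2 - \<eta> * (\<mu> + L)) * I)"
    by (simp add: algebra_simps power2_eq_square)
  also have "\<dots> \<le> N - \<eta>\<^sup>2 * \<mu> * L * N - \<eta> * ((2 - \<eta> * (\<mu> + L)) * (\<mu> * N))"
    using mono s \<eta> by (intro diff_left_mono mult_left_mono) auto
  also have "\<dots> = (1 - \<mu> * \<eta> * (2 - \<mu> * \<eta>)) * N"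
    by (simp add: algebra_simps power2_eq_square)
  finally show ?thesis by (simp add: N_def)
qed

text \<open>The constant is not sharp; it only serves to carry square integrability from the
  iterates to their gradients.\<close>

lemma gradient_lipschitz:
  fixes f :: "real^'d \<Rightarrow> real"
  assumes f: "smooth_strongly_convex \<mu> L f g" and \<mu>: "0 < \<mu>" "\<mu> \<le> L"
  shows "norm (g x - g y) \<le> (\<mu> + L) * norm (x - y)"
proof (cases "g x = g y")
  case False
  have "norm (g x - g y) * norm (g x - g y) \<le> (\<mu> + L) * ((g x - g y) \<bullet> (x - y)) - \<mu> * L * (norm (x - y))\<^sup>2"
    using gradient_cocoercive[OF f \<mu>(2), of x y] by (simp add: power2_eq_square)
  also have "\<dots> \<le> (\<mu> + L) * ((g x - g y) \<bullet> (x - y))" using \<mu> by simp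
  also have "\<dots> \<le> (\<mu> + L) * (norm (g x - g y) * norm (x - y))"
    using \<mu> by (intro mult_left_mono norm_cauchy_schwarz) auto
  finally show ?thesis using False by (simp add: mult_ac)
qed (use \<mu> in simp)

text \<open>The sum is smooth with constant \<open>c = n L\<close>. A gradient step of length
  \<open>1 / c\<close> lowers it by at least \<open>(s \<bullet> s) / (2 * c)\<close>, which
  contradicts minimality unless \<open>s = 0\<close>.\<close>

lemma sum_gradients_at_minimizer:
  fixes f :: "'n::finite \<Rightarrow> real^'d \<Rightarrow> real"
  assumes f: "\<And>i. smooth_strongly_convex \<mu> L (f i) (g i)" and L: "0 < L"
    and min: "\<And>x. (\<Sum>i\<in>UNIV. f i xs) \<le> (\<Sum>i\<in>UNIV. f i x)"
  shows "(\<Sum>i\<in>UNIV. g i xs) = 0"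
proof -
  define s where "s = (\<Sum>i\<in>UNIV. g i xs)"
  define c where "c = real CARD('n) * L"
  have c: "c > 0" using L by (simp add: c_def)
  define x where "x = xs - (1 / c) *\<^sub>R s"
  have "(\<Sum>i\<in>UNIV. f i xs) \<le> (\<Sum>i\<in>UNIV. f i x)" by (rule min)
  also have "\<dots> \<le> (\<Sum>i\<in>UNIV. f i xs + g i xs \<bullet> (x - xs) + L / 2 * (norm (x - xs))\<^sup>2)"
    using f by (intro sum_mono) (auto simp: smooth_strongly_convex_def)
  also have "\<dots> = (\<Sum>i\<in>UNIV. f i xs) + s \<bullet> (x - xs) + c / 2 * (norm (x - xs))\<^sup>2"
    by (simp add: sum.distrib s_def c_def inner_sum_left)
  also have "\<dots> = (\<Sum>i\<in>UNIV. f i xs) - (s \<bullet> s) / (2 * c)"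
  proof -
    have e: "x - xs = - ((1 / c) *\<^sub>R s)" by (simp add: x_def)
    show ?thesis unfolding power2_norm_eq_inner e using c by (simp add: field_simps)
  qed
  finally have "s \<bullet> s \<le> 0" using c by (simp add: divide_le_0_iff)
  hence "s \<bullet> s = 0" by (intro antisym) simp_all
  thus ?thesis by (simp add: s_def)
qed

(* Right side minus left side is concave in s, so it suffices to look at the end points of the
   range of s.  In the application t = beta * gamma and s = (1 + C) * alpha. *)
lemma compression_parameters_aux:
  fixes C t s :: real
  assumes C: "0 \<le> C" and t: "0 < t" "(3 * C + 1) * t < 2"
    and s: "C * t / 2 \<le> s" "s \<le> (C * t + 2) * (2 - t) / (4 * (4 - t))"
  shows "C * t / 2 * (1 + t / 2) * (C * t + 2) \<le> 4 * s * (1 - s + C * t\<^sup>2 / 4)"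
proof -
  \<comment> \<open>The claim depends on \<open>C\<close> only through \<open>u\<close>, and the
    condition on \<open>t\<close> becomes \<open>3 * u + t < 2\<close>.\<close>
  define u where "u = C * t"
  have u: "0 \<le> u" "3 * u < 2 - t" using C t by (auto simp: u_def algebra_simps)
  have t2: "t < 2" using u by simp
  define S where "S = (u + 2) * (2 - t) / (4 * (4 - t))"
  define F where "F = (\<lambda>s. 4 * s * (1 - s + u * t / 4) - u / 2 * (1 + t / 2) * (u + 2))"
  have s: "u / 2 \<le> s" "s \<le> S" using s by (simp_all add: u_def S_def)
  \<comment> \<open>At the lower end \<open>F\<close> is nonnegative because of
    \<open>3 * u < 2 - t\<close>, which is the bound with the factor
    \<open>3 * C + 1\<close>.\<close>
  have F0: "F (u / 2) \<ge> 0"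
  proof -
    have "F (u / 2) = u / 4 * (2 * (2 - t - 3 * u) + u * t)"
      by (simp add: F_def field_simps)
    also have "\<dots> \<ge> 0" using u t by simp
    finally show ?thesis .
  qed
  have F1: "F S \<ge> 0"
  proof -
    \<comment> \<open>\<open>P\<close> and \<open>R\<close> come from clearing denominators in
      \<open>F S\<close>, which leaves \<open>(2 - t) * P - u * R\<close> up to a positive factor.
      With \<open>3 * u < 2 - t\<close> it suffices that \<open>R \<le> 3 * P\<close>.\<close>
    define P R where "P = 12 - 2 * t - 2 * u + 5 * u * t - u * t\<^sup>2" and "R = (2 + t) * (4 - t)\<^sup>2"
    have P: "3 * P \<ge> R"
    proof -
      \<comment> \<open>\<open>3 * P - R\<close> is affine in \<open>u\<close>, so it is checked at
        the two ends of the range from \<open>0\<close> to \<open>(2 - t) / 3\<close>;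
        \<open>l\<close> is the interpolation parameter.\<close>
      define l where "l = 3 * u / (2 - t)"
      have l: "0 \<le> l" "l \<le> 1" and ul: "u = l * (2 - t) / 3"
        using u t2 by (auto simp: l_def field_simps)
      have "4 - 6 * t + 6 * t\<^sup>2 - t ^ 3 = (2 - t) ^ 3 / 2 + t * t * (6 - t) / 2"
        by (simp add: power2_eq_square power3_eq_cube field_simps)
      also have "\<dots> \<ge> 0" using t t2 by simp
      finally have q: "4 - 6 * t + 6 * t\<^sup>2 - t ^ 3 \<ge> 0" .
      have "3 * P - R = (1 - l) * (4 - 6 * t + 6 * t\<^sup>2 - t ^ 3) + l * (t * (6 - t))"
        by (simp add: P_def R_def ul power2_eq_square power3_eq_cube field_simps)
      also have "\<dots> \<ge> 0" using q l t t2 by simp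
      finally show ?thesis by simp
    qed
    have "F S = (u + 2) / (4 * (4 - t)\<^sup>2) * ((2 - t) * P - u * R)"
    proof -
      define z where "z = 4 - t"
      have z: "z > 0" "t = 4 - z" using t2 by (auto simp: z_def)
      show ?thesis using z(1) unfolding F_def S_def P_def R_def z(2)
        by (simp add: field_simps power2_eq_square)
    qed
    also have "\<dots> \<ge> 0"
    proof -
      have R: "R \<ge> 0" using t by (simp add: R_def)
      have "u * R \<le> (2 - t) / 3 * R" using u R by (intro mult_right_mono) auto
      also have "\<dots> \<le> (2 - t) / 3 * (3 * P)" using P t2 by (intro mult_left_mono) auto
      finally show ?thesis using u by simp
    qed
    finally show ?thesis .
  qed
  have "F s \<ge> 0"
  proof (cases "S = u / 2")
    case True
    hence "s = u / 2" using s by simp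
    thus ?thesis using F0 by (simp only:)
  next
    case False
    \<comment> \<open>For a quadratic with leading coefficient \<open>-4\<close> the excess over the
      chord is \<open>4 * (s - u / 2) * (S - s)\<close>; the identity is multiplied by
      \<open>S - u / 2\<close>.\<close>
    have "(S - u / 2) * F s = (S - s) * F (u / 2) + (s - u / 2) * F S + 4 * ((s - u / 2) * (S - s) * (S - u / 2))"
      by (simp add: F_def field_simps)
    also have "\<dots> \<ge> 0" using s F0 F1 by simp
    finally show ?thesis using s False by (simp add: zero_le_mult_iff)
  qed
  thus ?thesis by (simp add: F_def u_def power2_eq_square mult_ac)
qed

(* The coefficient of the squared compression error in the descent inequality. *)
lemma compression_parameters:
  fixes C \<beta> \<gamma> \<alpha> a :: real
  assumes C: "0 \<le> C" and t: "0 < \<beta> * \<gamma>" "(3 * C + 1) * (\<beta> * \<gamma>) < 2"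
    and a: "a = 4 * (1 + C) / (C * \<beta> * \<gamma> + 2)"
    and \<alpha>: "C * \<beta> * \<gamma> / (2 * (1 + C)) \<le> \<alpha>" "a * \<alpha> \<le> (2 - \<beta> * \<gamma>) / (4 - \<beta> * \<gamma>)"
  shows "C * ((1 - a * \<alpha>) * (\<gamma>\<^sup>2 / 4) * \<beta>\<^sup>2 + \<gamma> / 2 * \<beta> + a * \<alpha>\<^sup>2) \<le> a * \<alpha> * (1 - \<alpha>)"
proof -
  \<comment> \<open>In these variables \<open>a * \<alpha> = 4 * s / (C * t + 2)\<close> and the
    lower bound on \<open>\<alpha>\<close> reads \<open>C * t / 2 \<le> s\<close>.\<close>
  define t s where "t = \<beta> * \<gamma>" and "s = (1 + C) * \<alpha>"
  define w where "w = C * t + 2"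
  have t': "0 < t" "(3 * C + 1) * t < 2" using t by (simp_all add: t_def)
  have w: "w > 0" using C t' by (simp add: w_def add_nonneg_pos)
  have "0 \<le> C * t" "(3 * C + 1) * t = 3 * (C * t) + t" using C t' by (simp_all add: algebra_simps)
  hence t2: "t < 2" using t' by linarith
  have a': "a = 4 * (1 + C) / w" by (simp add: a w_def t_def mult_ac)
  have as: "a * \<alpha> = 4 * s / w" by (simp add: a' s_def)
  have s1: "C * t / 2 \<le> s"
    using \<alpha>(1) C by (simp add: t_def s_def field_simps)
  have "4 * s / w \<le> (2 - t) / (4 - t)" using \<alpha>(2) by (simp add: as t_def)
  hence "s \<le> w * (2 - t) / (4 * (4 - t))" using w t2 by (simp add: field_simps)
  hence "C * t / 2 * (1 + t / 2) * (C * t + 2) \<le> 4 * s * (1 - s + C * t\<^sup>2 / 4)"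
    unfolding w_def by (intro compression_parameters_aux C t' s1)
  hence *: "C * t / 2 * (1 + t / 2) \<le> 4 * s / w * (1 - s + C * t\<^sup>2 / 4)"
    unfolding w_def[symmetric] using w by (simp add: field_simps)
  have "a * \<alpha> * (1 - \<alpha>) - C * ((1 - a * \<alpha>) * (\<gamma>\<^sup>2 / 4) * \<beta>\<^sup>2 + \<gamma> / 2 * \<beta> + a * \<alpha>\<^sup>2)
     = a * \<alpha> * (1 - s + C * t\<^sup>2 / 4) - C * t / 2 * (1 + t / 2)"
    by (simp add: s_def t_def power2_eq_square field_simps)
  thus ?thesis using * unfolding as by simp
qed

(* One iteration along a sample path, relative to the optimum: e is the compression error and S
   the pseudoinverse of T.  The last term is linear in e and vanishes in expectation. *)
lemma lead_descent:
  fixes T S :: "'v::real_inner \<Rightarrow> 'v"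
  assumes T: "linear T" "\<And>u w. u \<bullet> T w = T u \<bullet> w" and S: "linear S" "\<And>u w. u \<bullet> S w = S u \<bullet> w"
    and TST: "\<And>u. T (S (T u)) = T u" and d: "\<And>u. d \<bullet> S (T u) = d \<bullet> u"
    and psd: "\<And>u. 0 \<le> u \<bullet> T u" and le: "\<And>u. u \<bullet> T u \<le> \<beta> * (norm u)\<^sup>2"
    and sq: "\<And>u. (norm (T u))\<^sup>2 \<le> \<beta> * (u \<bullet> T u)" and Sle: "d \<bullet> S d \<le> l * (norm d)\<^sup>2" and l: "0 < l"
    and pos: "0 < \<eta>" "0 < \<gamma>" "0 \<le> \<beta>" and t: "\<beta> * \<gamma> < 2"
    and b: "b \<le> (2 - \<beta> * \<gamma>) / (4 - \<beta> * \<gamma>)" and b_def: "b = a * \<alpha>"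
    and y: "y = v - \<eta> *\<^sub>R d"
  shows "(1 - b) * (norm (y - (\<gamma> / 2) *\<^sub>R T (y + e)))\<^sup>2
       + 2 * \<eta>\<^sup>2 / \<gamma> * ((d + (\<gamma> / (2 * \<eta>)) *\<^sub>R T (y + e)) \<bullet> S (d + (\<gamma> / (2 * \<eta>)) *\<^sub>R T (y + e)))
       + a * (norm ((1 - \<alpha>) *\<^sub>R h + \<alpha> *\<^sub>R (y + e)))\<^sup>2
     \<le> (norm v)\<^sup>2 + (1 - \<gamma> / (2 * l)) * (2 * \<eta>\<^sup>2 / \<gamma> * (d \<bullet> S d)) + (1 - \<alpha>) * (a * (norm h)\<^sup>2)
       + ((1 - b) * (\<gamma>\<^sup>2 / 4) * \<beta>\<^sup>2 + \<gamma> / 2 * \<beta> + a * \<alpha>\<^sup>2) * (norm e)\<^sup>2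
       - a * \<alpha> * (1 - \<alpha>) * (norm (y - h))\<^sup>2
       + ((1 - b) *\<^sub>R ((\<gamma>\<^sup>2 / 2) *\<^sub>R T (T y) - \<gamma> *\<^sub>R T y) + (2 * \<eta>) *\<^sub>R d + \<gamma> *\<^sub>R T y
          + (2 * a * \<alpha>) *\<^sub>R ((1 - \<alpha>) *\<^sub>R h + \<alpha> *\<^sub>R y)) \<bullet> e"
proof -
  have b1: "b \<le> 1"
  proof -
    have "(2 - \<beta> * \<gamma>) / (4 - \<beta> * \<gamma>) \<le> 1" using t by simp
    thus ?thesis using b by linarith
  qed
  define w where "w = T (y + e)"
  have w: "w = T y + T e" by (simp add: w_def linear_add[OF T(1)])
  define q where "q = (1 - b) *\<^sub>R ((\<gamma>\<^sup>2 / 2) *\<^sub>R T (T y) - \<gamma> *\<^sub>R T y) + (2 * \<eta>) *\<^sub>R d + \<gamma> *\<^sub>R T y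
          + (2 * a * \<alpha>) *\<^sub>R ((1 - \<alpha>) *\<^sub>R h + \<alpha> *\<^sub>R y)"
  have ye: "y \<bullet> T e = T y \<bullet> e" "T y \<bullet> T e = T (T y) \<bullet> e" by (rule T(2))+
  \<comment> \<open>\<open>S\<close> inverts \<open>T\<close> when paired with \<open>d\<close> or
    with the range of \<open>T\<close>. The cross terms thus reduce to
    \<open>d \<bullet> (y + e)\<close> and the square to \<open>(y + e) \<bullet> w\<close>, and
    \<open>S\<close> survives only in \<open>d \<bullet> S d\<close>.\<close>
  have D: "2 * \<eta>\<^sup>2 / \<gamma> * ((d + (\<gamma> / (2 * \<eta>)) *\<^sub>R w) \<bullet> S (d + (\<gamma> / (2 * \<eta>)) *\<^sub>R w))
      = 2 * \<eta>\<^sup>2 / \<gamma> * (d \<bullet> S d) + 2 * \<eta> * (d \<bullet> (y + e)) + \<gamma> / 2 * ((y + e) \<bullet> w)"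
  proof -
    have 1: "d \<bullet> S w = d \<bullet> (y + e)" unfolding w_def by (rule d)
    have 2: "w \<bullet> S d = d \<bullet> (y + e)" using 1 S(2)[of d w] by (simp add: inner_commute)
    have 3: "w \<bullet> S w = (y + e) \<bullet> w"
      using T(2)[of "y + e" "S (T (y + e))"] by (simp add: w_def TST)
    have "(d + k *\<^sub>R w) \<bullet> S (d + k *\<^sub>R w) = d \<bullet> S d + 2 * k * (d \<bullet> (y + e)) + k\<^sup>2 * ((y + e) \<bullet> w)"
      for k
    proof -
      have "(d + k *\<^sub>R w) \<bullet> S (d + k *\<^sub>R w)
          = d \<bullet> S d + k * (d \<bullet> S w) + k * (w \<bullet> S d) + k * (k * (w \<bullet> S w))"
        by (simp add: linear_add[OF S(1)] linear_cmul[OF S(1)] inner_add_left inner_add_right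
            distrib_left)
      thus ?thesis unfolding 1 2 3 by (simp add: power2_eq_square)
    qed
    from this[of "\<gamma> / (2 * \<eta>)"] have "2 * \<eta>\<^sup>2 / \<gamma> * ((d + (\<gamma> / (2 * \<eta>)) *\<^sub>R w) \<bullet> S (d + (\<gamma> / (2 * \<eta>)) *\<^sub>R w))
      = 2 * \<eta>\<^sup>2 / \<gamma> * (d \<bullet> S d) + 2 * \<eta>\<^sup>2 / \<gamma> * (2 * (\<gamma> / (2 * \<eta>))) * (d \<bullet> (y + e))
        + 2 * \<eta>\<^sup>2 / \<gamma> * (\<gamma> / (2 * \<eta>))\<^sup>2 * ((y + e) \<bullet> w)"
      by (simp only: distrib_left mult.assoc)
    moreover have "2 * \<eta>\<^sup>2 / \<gamma> * (2 * (\<gamma> / (2 * \<eta>))) = 2 * \<eta>" "2 * \<eta>\<^sup>2 / \<gamma> * (\<gamma> / (2 * \<eta>))\<^sup>2 = \<gamma> / 2"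
      using pos by (simp_all add: field_simps power2_eq_square)
    ultimately show ?thesis by (simp only:)
  qed
  \<comment> \<open>Completing the square yields both the \<open>- (norm y)\<^sup>2\<close> that
    cancels against the other two terms and the \<open>- \<eta>\<^sup>2 * (norm d)\<^sup>2\<close>
    that contracts the dual term.\<close>
  have dv: "2 * \<eta> * (d \<bullet> y) = (norm v)\<^sup>2 - (norm y)\<^sup>2 - \<eta>\<^sup>2 * (norm d)\<^sup>2"
    unfolding power2_norm_eq_inner y
    by (simp add: inner_diff_left inner_diff_right inner_commute power2_eq_square algebra_simps)
  have eq: "(1 - b) * (norm (y - (\<gamma> / 2) *\<^sub>R w))\<^sup>2
       + 2 * \<eta>\<^sup>2 / \<gamma> * ((d + (\<gamma> / (2 * \<eta>)) *\<^sub>R w) \<bullet> S (d + (\<gamma> / (2 * \<eta>)) *\<^sub>R w))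
       + a * (norm ((1 - \<alpha>) *\<^sub>R h + \<alpha> *\<^sub>R (y + e)))\<^sup>2
     = (norm v)\<^sup>2 + (2 * \<eta>\<^sup>2 / \<gamma> * (d \<bullet> S d) - \<eta>\<^sup>2 * (norm d)\<^sup>2) + (1 - \<alpha>) * (a * (norm h)\<^sup>2)
       + (1 - b) * (\<gamma>\<^sup>2 / 4) * (norm (T e))\<^sup>2 + \<gamma> / 2 * (e \<bullet> T e) + a * \<alpha>\<^sup>2 * (norm e)\<^sup>2
       - a * \<alpha> * (1 - \<alpha>) * (norm (y - h))\<^sup>2
       + ((1 - b) * (\<gamma>\<^sup>2 / 4) * (norm (T y))\<^sup>2 - \<gamma> * (1 / 2 - b) * (y \<bullet> T y)) + q \<bullet> e"
  proof -
    have comm: "e \<bullet> T y = T y \<bullet> e" "T e \<bullet> y = T y \<bullet> e" "T e \<bullet> T y = T (T y) \<bullet> e"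
        "y \<bullet> h = h \<bullet> y" "e \<bullet> h = h \<bullet> e" "e \<bullet> y = y \<bullet> e" "T y \<bullet> y = y \<bullet> T y"
      using ye by (simp_all add: inner_commute)
    have n1: "(norm (y - (\<gamma> / 2) *\<^sub>R w))\<^sup>2 = (norm y)\<^sup>2 - \<gamma> * (y \<bullet> T y) - \<gamma> * (T y \<bullet> e)
        + \<gamma>\<^sup>2 / 4 * ((norm (T y))\<^sup>2 + 2 * (T (T y) \<bullet> e) + (norm (T e))\<^sup>2)"
      unfolding w power2_norm_eq_inner
      by (simp add: inner_add_left inner_add_right inner_diff_left inner_diff_right ye comm
          power2_eq_square field_simps)
    have n2: "(y + e) \<bullet> w = y \<bullet> T y + 2 * (T y \<bullet> e) + e \<bullet> T e"
      by (simp add: w inner_add_left inner_add_right ye comm)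
    have n3: "(norm ((1 - \<alpha>) *\<^sub>R h + \<alpha> *\<^sub>R (y + e)))\<^sup>2 = (1 - \<alpha>)\<^sup>2 * (norm h)\<^sup>2
        + 2 * \<alpha> * (1 - \<alpha>) * (h \<bullet> y + h \<bullet> e) + \<alpha>\<^sup>2 * ((norm y)\<^sup>2 + 2 * (y \<bullet> e) + (norm e)\<^sup>2)"
      unfolding power2_norm_eq_inner
      by (simp add: inner_add_left inner_add_right comm power2_eq_square algebra_simps)
    have n4: "(norm (y - h))\<^sup>2 = (norm y)\<^sup>2 - 2 * (h \<bullet> y) + (norm h)\<^sup>2"
      unfolding power2_norm_eq_inner by (simp add: inner_diff_left inner_diff_right comm)
    have n5: "q \<bullet> e = (1 - b) * (\<gamma>\<^sup>2 / 2 * (T (T y) \<bullet> e) - \<gamma> * (T y \<bullet> e)) + 2 * \<eta> * (d \<bullet> e)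
        + \<gamma> * (T y \<bullet> e) + 2 * a * \<alpha> * ((1 - \<alpha>) * (h \<bullet> e) + \<alpha> * (y \<bullet> e))"
      by (simp add: q_def inner_add_left inner_diff_left)
    show ?thesis
      unfolding D inner_add_right[of d] distrib_left[of "2 * \<eta>"] dv n1 n2 n3 n4 n5 b_def
      by (simp add: power2_eq_square field_simps)
  qed
  \<comment> \<open>The leftover \<open>- \<eta>\<^sup>2 * (norm d)\<^sup>2\<close> is compared with
    \<open>d \<bullet> S d\<close> through \<open>l\<close>; this is the origin of the dual rate
    \<open>1 - \<gamma> / (2 * l)\<close>.\<close>
  have dS: "2 * \<eta>\<^sup>2 / \<gamma> * (d \<bullet> S d) - \<eta>\<^sup>2 * (norm d)\<^sup>2 \<le> (1 - \<gamma> / (2 * l)) * (2 * \<eta>\<^sup>2 / \<gamma> * (d \<bullet> S d))"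
  proof -
    have "\<eta>\<^sup>2 / l * (d \<bullet> S d) \<le> \<eta>\<^sup>2 / l * (l * (norm d)\<^sup>2)"
      using Sle l by (intro mult_left_mono) auto
    thus ?thesis using l pos by (simp add: field_simps)
  qed
  have Te: "(1 - b) * (\<gamma>\<^sup>2 / 4) * (norm (T e))\<^sup>2 \<le> (1 - b) * (\<gamma>\<^sup>2 / 4) * (\<beta>\<^sup>2 * (norm e)\<^sup>2)"
  proof (rule mult_left_mono)
    have "(norm (T e))\<^sup>2 \<le> \<beta> * (e \<bullet> T e)" by (rule sq)
    also have "\<dots> \<le> \<beta> * (\<beta> * (norm e)\<^sup>2)" using le pos by (intro mult_left_mono) auto
    finally show "(norm (T e))\<^sup>2 \<le> \<beta>\<^sup>2 * (norm e)\<^sup>2" by (simp add: power2_eq_square)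
  qed (use b1 in simp)
  have eTe: "\<gamma> / 2 * (e \<bullet> T e) \<le> \<gamma> / 2 * (\<beta> * (norm e)\<^sup>2)"
    using le pos by (intro mult_left_mono) auto
  \<comment> \<open>After \<open>sq\<close> the coefficient is a nonnegative multiple of
    \<open>(1 - b) * (\<gamma> * \<beta>) - (2 - 4 * b)\<close>, which the bound on \<open>b\<close>
    makes nonpositive.\<close>
  have Ty: "(1 - b) * (\<gamma>\<^sup>2 / 4) * (norm (T y))\<^sup>2 - \<gamma> * (1 / 2 - b) * (y \<bullet> T y) \<le> 0"
  proof -
    have "(1 - b) * (\<gamma>\<^sup>2 / 4) * (norm (T y))\<^sup>2 \<le> (1 - b) * (\<gamma>\<^sup>2 / 4) * (\<beta> * (y \<bullet> T y))"
      using b1 by (intro mult_left_mono sq) auto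
    moreover have "b * (4 - \<beta> * \<gamma>) \<le> 2 - \<beta> * \<gamma>" using b t by (simp add: field_simps)
    hence "(1 - b) * (\<gamma> * \<beta>) \<le> 2 - 4 * b" by (simp add: algebra_simps)
    hence "\<gamma> / 4 * (y \<bullet> T y) * ((1 - b) * (\<gamma> * \<beta>)) \<le> \<gamma> / 4 * (y \<bullet> T y) * (2 - 4 * b)"
      using psd[of y] pos by (intro mult_left_mono) auto
    moreover have "(1 - b) * (\<gamma>\<^sup>2 / 4) * (\<beta> * (y \<bullet> T y)) = \<gamma> / 4 * (y \<bullet> T y) * ((1 - b) * (\<gamma> * \<beta>))"
      "\<gamma> / 4 * (y \<bullet> T y) * (2 - 4 * b) = \<gamma> * (1 / 2 - b) * (y \<bullet> T y)"
      by (simp_all add: power2_eq_square field_simps)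
    ultimately show ?thesis by linarith
  qed
  have "((1 - b) * (\<gamma>\<^sup>2 / 4) * \<beta>\<^sup>2 + \<gamma> / 2 * \<beta> + a * \<alpha>\<^sup>2) * (norm e)\<^sup>2
      = (1 - b) * (\<gamma>\<^sup>2 / 4) * (\<beta>\<^sup>2 * (norm e)\<^sup>2) + \<gamma> / 2 * (\<beta> * (norm e)\<^sup>2) + a * \<alpha>\<^sup>2 * (norm e)\<^sup>2"
    by (simp only: distrib_right mult.assoc)
  thus ?thesis
    unfolding w_def[symmetric] q_def[symmetric] eq
    using dS Te eTe Ty by linarith
qed

section \<open>Independent noise\<close>

lemma borel_measurable_vec:
  fixes E :: "'a \<Rightarrow> ('v::euclidean_space)^'n::finite"
  assumes "\<And>i. (\<lambda>w. E w $ i) \<in> borel_measurable F"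
  shows "E \<in> borel_measurable F"
proof (rule borel_measurable_euclidean_space[THEN iffD2], rule ballI)
  fix c :: "'v^'n" assume "c \<in> Basis"
  then obtain i u where c: "c = axis i u" by (auto simp: Basis_vec_def)
  have "(\<lambda>w. E w $ i \<bullet> u) \<in> borel_measurable F" using assms[of i] by measurable
  thus "(\<lambda>w. E w \<bullet> c) \<in> borel_measurable F" by (simp add: c inner_axis)
qed

context prob_space
begin

section \<open>Square integrable random vectors\<close>

definition square_integrable :: "('a \<Rightarrow> 'v::euclidean_space) \<Rightarrow> bool" where
  "square_integrable V \<longleftrightarrow> random_variable borel V \<and> integrable M (\<lambda>w. (norm (V w))\<^sup>2)"

lemma square_integrable_bound:
  assumes "square_integrable U" "random_variable borel V" "\<And>w. w \<in> space M \<Longrightarrow> norm (V w) \<le> c * norm (U w)"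
  shows "square_integrable V"
  unfolding square_integrable_def
proof
  show "integrable M (\<lambda>w. (norm (V w))\<^sup>2)"
  proof (rule Bochner_Integration.integrable_bound)
    show "integrable M (\<lambda>w. c\<^sup>2 * (norm (U w))\<^sup>2)"
      using assms(1) by (simp add: square_integrable_def)
    show "AE w in M. norm ((norm (V w))\<^sup>2) \<le> norm (c\<^sup>2 * (norm (U w))\<^sup>2)"
    proof (rule AE_I2)
      fix w assume "w \<in> space M"
      hence "(norm (V w))\<^sup>2 \<le> (c * norm (U w))\<^sup>2" by (intro power_mono assms) auto
      thus "norm ((norm (V w))\<^sup>2) \<le> norm (c\<^sup>2 * (norm (U w))\<^sup>2)" by (simp add: power_mult_distrib)
    qed
  qed (use assms(2) in measurable)
qed (fact assms)

lemma square_integrable_add: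
  assumes "square_integrable U" "square_integrable V"
  shows "square_integrable (\<lambda>w. U w + V w)"
  unfolding square_integrable_def
proof
  have [measurable]: "random_variable borel U" "random_variable borel V"
    using assms by (auto simp: square_integrable_def)
  show "random_variable borel (\<lambda>w. U w + V w)" by measurable
  show "integrable M (\<lambda>w. (norm (U w + V w))\<^sup>2)"
  proof (rule Bochner_Integration.integrable_bound)
    show "integrable M (\<lambda>w. 2 * (norm (U w))\<^sup>2 + 2 * (norm (V w))\<^sup>2)"
      using assms by (simp add: square_integrable_def)
    show "AE w in M. norm ((norm (U w + V w))\<^sup>2) \<le> norm (2 * (norm (U w))\<^sup>2 + 2 * (norm (V w))\<^sup>2)"
    proof (rule AE_I2)
      fix w
      have "(norm (U w + V w))\<^sup>2 \<le> (norm (U w) + norm (V w))\<^sup>2"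
        by (intro power_mono norm_triangle_ineq) auto
      also have "\<dots> \<le> 2 * (norm (U w))\<^sup>2 + 2 * (norm (V w))\<^sup>2"
        using sum_squares_bound[of "norm (U w)" "norm (V w)"] by (simp add: power2_sum)
      finally show "norm ((norm (U w + V w))\<^sup>2) \<le> norm (2 * (norm (U w))\<^sup>2 + 2 * (norm (V w))\<^sup>2)" by simp
    qed
  qed measurable
qed

lemma square_integrable_bounded_linear:
  assumes U: "square_integrable U" and T: "bounded_linear T"
  shows "square_integrable (\<lambda>w. T (U w))"
proof -
  obtain c where c: "\<And>x. norm (T x) \<le> norm x * c" using bounded_linear.bounded[OF T] by blast
  have [measurable]: "T \<in> borel_measurable borel"
    using T by (intro borel_measurable_continuous_onI linear_continuous_on)
  have [measurable]: "random_variable borel U" using U by (auto simp: square_integrable_def)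
  show ?thesis
    by (rule square_integrable_bound[OF U, where c = c]) (use c in \<open>auto simp: mult.commute\<close>)
qed

lemma square_integrable_scaleR: "square_integrable U \<Longrightarrow> square_integrable (\<lambda>w. c *\<^sub>R U w)"
  by (rule square_integrable_bounded_linear[OF _ bounded_linear_scaleR_right])

lemma square_integrable_const: "square_integrable (\<lambda>w. c)"
  by (simp add: square_integrable_def)

lemma square_integrable_diff:
  assumes "square_integrable U" "square_integrable V"
  shows "square_integrable (\<lambda>w. U w - V w)"
  using square_integrable_add[OF assms(1) square_integrable_scaleR[OF assms(2), of "-1"]] by simp

lemma square_integrable_nth: "square_integrable U \<Longrightarrow> square_integrable (\<lambda>w. U w $ i)"
  for U :: "'a \<Rightarrow> ('v::euclidean_space)^'n"
  by (rule square_integrable_bounded_linear[OF _ bounded_linear_vec_nth])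

lemma square_integrable_inner:
  assumes "square_integrable U" "square_integrable V"
  shows "integrable M (\<lambda>w. U w \<bullet> V w)"
proof (rule Bochner_Integration.integrable_bound)
  have [measurable]: "random_variable borel U" "random_variable borel V"
    using assms by (auto simp: square_integrable_def)
  show "random_variable borel (\<lambda>w. U w \<bullet> V w)" by measurable
  show "integrable M (\<lambda>w. (norm (U w))\<^sup>2 + (norm (V w))\<^sup>2)"
    using assms by (simp add: square_integrable_def)
  show "AE w in M. norm (U w \<bullet> V w) \<le> norm ((norm (U w))\<^sup>2 + (norm (V w))\<^sup>2)"
  proof (rule AE_I2)
    fix w
    have "norm (U w \<bullet> V w) \<le> norm (U w) * norm (V w)" by (simp add: Cauchy_Schwarz_ineq2)
    moreover have "0 \<le> norm (U w) * norm (V w)" by simp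
    ultimately show "norm (U w \<bullet> V w) \<le> norm ((norm (U w))\<^sup>2 + (norm (V w))\<^sup>2)"
      using sum_squares_bound[of "norm (U w)" "norm (V w)"] by simp
  qed
qed

(* The library's indep_var requires both variables to have the same type. *)
definition independent_rv :: "'b measure \<Rightarrow> ('a \<Rightarrow> 'b) \<Rightarrow> 'c measure \<Rightarrow> ('a \<Rightarrow> 'c) \<Rightarrow> bool" where
  "independent_rv N V N' R \<longleftrightarrow> random_variable N V \<and> random_variable N' R \<and>
     (\<forall>X\<in>sets N. \<forall>Y\<in>sets N'. prob ((V -` X \<inter> space M) \<inter> (R -` Y \<inter> space M))
        = prob (V -` X \<inter> space M) * prob (R -` Y \<inter> space M))"

section \<open>Moments of noise evaluated at an independent random argument\<close>

text \<open>Both sides agree on rectangles. The product law is what lets Fubini's theorem stand in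
  for conditioning.\<close>

lemma independent_rv_distr:
  assumes "independent_rv N V N' R"
  shows "distr M N V \<Otimes>\<^sub>M distr M N' R = distr M (N \<Otimes>\<^sub>M N') (\<lambda>w. (V w, R w))"
proof (rule pair_measure_eqI)
  have V [measurable]: "random_variable N V" and R [measurable]: "random_variable N' R"
    and ind: "\<And>X Y. X \<in> sets N \<Longrightarrow> Y \<in> sets N' \<Longrightarrow>
      prob ((V -` X \<inter> space M) \<inter> (R -` Y \<inter> space M)) = prob (V -` X \<inter> space M) * prob (R -` Y \<inter> space M)"
    using assms by (auto simp: independent_rv_def)
  interpret V: prob_space "distr M N V" by (rule prob_space_distr) (rule V)
  interpret R: prob_space "distr M N' R" by (rule prob_space_distr) (rule R)
  show "sigma_finite_measure (distr M N V)" "sigma_finite_measure (distr M N' R)" by unfold_locales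
  show "sets (distr M N V \<Otimes>\<^sub>M distr M N' R) = sets (distr M (N \<Otimes>\<^sub>M N') (\<lambda>w. (V w, R w)))"
    by (simp cong: sets_pair_measure_cong)
  fix X Y assume "X \<in> sets (distr M N V)" "Y \<in> sets (distr M N' R)"
  hence XY [measurable]: "X \<in> sets N" "Y \<in> sets N'" by simp_all
  have "(\<lambda>w. (V w, R w)) -` (X \<times> Y) \<inter> space M = (V -` X \<inter> space M) \<inter> (R -` Y \<inter> space M)" by auto
  thus "emeasure (distr M N V) X * emeasure (distr M N' R) Y
      = emeasure (distr M (N \<Otimes>\<^sub>M N') (\<lambda>w. (V w, R w))) (X \<times> Y)"
    by (simp add: emeasure_distr emeasure_eq_measure ind[OF XY] ennreal_mult)
qed

text \<open>\<open>A\<close> is the argument of the noise and \<open>U\<close> a vector to test it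
  against. Their pair has law \<open>D\<close> and is independent of \<open>R\<close>, whose law is
  \<open>N\<close>; integrating over \<open>N\<close> first freezes \<open>A\<close> and
  \<open>U\<close> and leaves the moments of \<open>K x\<close> for fixed \<open>x\<close>.\<close>

lemma independent_noise:
  fixes K :: "'v::euclidean_space \<Rightarrow> 'z \<Rightarrow> 'v" and R :: "'a \<Rightarrow> 'z"
  assumes ind: "independent_rv borel (\<lambda>w. (A w, U w)) N R" and dR: "distr M N R = N"
    and K [measurable]: "case_prod K \<in> borel_measurable (borel \<Otimes>\<^sub>M N)"
    and K1: "\<And>x. integrable N (K x)" "\<And>x. (LINT z|N. K x z) = 0"
    and K2: "\<And>x. integrable N (\<lambda>z. (norm (K x z))\<^sup>2)" "\<And>x. (LINT z|N. (norm (K x z))\<^sup>2) \<le> b x"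
    and b [measurable]: "b \<in> borel_measurable borel" and bA: "integrable M (\<lambda>w. b (A w))"
    and U: "square_integrable U"
  shows independent_noise_square_integrable: "square_integrable (\<lambda>w. K (A w) (R w))"
    and independent_noise_second_moment:
      "expectation (\<lambda>w. (norm (K (A w) (R w)))\<^sup>2) \<le> expectation (\<lambda>w. b (A w))"
    and independent_noise_centred: "expectation (\<lambda>w. U w \<bullet> K (A w) (R w)) = 0"
proof -
  let ?V = "\<lambda>w. (A w, U w)"
  have V: "?V \<in> borel_measurable M" and R [measurable]: "random_variable N R"
    and dVR: "distr M borel ?V \<Otimes>\<^sub>M distr M N R = distr M (borel \<Otimes>\<^sub>M N) (\<lambda>w. (?V w, R w))"
    using ind by (auto simp: independent_rv_def intro: independent_rv_distr)
  have A [measurable]: "A \<in> borel_measurable M"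
    using measurable_compose[OF V, of fst borel] by (simp add: borel_prod[symmetric])
  have U' [measurable]: "U \<in> borel_measurable M" using U by (simp add: square_integrable_def)
  define D where "D = distr M borel ?V"
  interpret D: prob_space D unfolding D_def by (rule prob_space_distr) (rule V)
  interpret N: prob_space N using prob_space_distr[OF R] by (simp add: dR)
  interpret DN: pair_prob_space D N ..
  have sD [measurable_cong]: "sets D = sets (borel \<Otimes>\<^sub>M borel)" by (simp only: D_def sets_distr borel_prod)
  have DNeq: "D \<Otimes>\<^sub>M N = distr M (D \<Otimes>\<^sub>M N) (\<lambda>w. (?V w, R w))"
    using dVR unfolding dR D_def[symmetric]
    by (metis D_def distr_cong sets_distr sets_pair_measure_cong)
  have VR [measurable]: "(\<lambda>w. (?V w, R w)) \<in> measurable M (D \<Otimes>\<^sub>M N)"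
    by measurable
  have VD [measurable]: "?V \<in> measurable M D" by measurable
  have D: "D = distr M D ?V" unfolding D_def by (rule distr_cong) simp_all
  have [measurable]: "(\<lambda>(v, z). K (fst v) z) \<in> borel_measurable (D \<Otimes>\<^sub>M N)" by measurable
  have fst_D [measurable]: "fst \<in> borel_measurable D" "snd \<in> borel_measurable D" by measurable
  have bD: "integrable D (\<lambda>v. b (fst v))"
    by (subst D, subst integrable_distr_eq) (use bA in auto)
  have b0: "0 \<le> b x" for x
    using K2(2)[of x] by (rule order_trans[rotated]) (intro Bochner_Integration.integral_nonneg, simp)
  define F :: "('v \<times> 'v) \<times> 'z \<Rightarrow> real" where "F = (\<lambda>(v, z). (norm (K (fst v) z))\<^sup>2)"
  have Fm [measurable]: "F \<in> borel_measurable (D \<Otimes>\<^sub>M N)" unfolding F_def by measurable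
  \<comment> \<open>The nonnegative integral comes first: integrability of \<open>F\<close> over the
    product is obtained from the iterated bound by Tonelli's theorem.\<close>
  have nF: "(\<integral>\<^sup>+ p. ennreal (F p) \<partial>(D \<Otimes>\<^sub>M N)) \<le> (\<integral>\<^sup>+ v. ennreal (b (fst v)) \<partial>D)"
  proof -
    have "(\<integral>\<^sup>+ p. ennreal (F p) \<partial>(D \<Otimes>\<^sub>M N)) = (\<integral>\<^sup>+ v. \<integral>\<^sup>+ z. ennreal (F (v, z)) \<partial>N \<partial>D)"
      by (rule N.nn_integral_fst[symmetric]) measurable
    also have "\<dots> \<le> (\<integral>\<^sup>+ v. ennreal (b (fst v)) \<partial>D)"
      by (intro nn_integral_mono) (simp add: F_def nn_integral_eq_integral K2 ennreal_leI)
    finally show ?thesis .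
  qed
  have F0: "0 \<le> F p" for p by (simp add: F_def split: prod.split)
  have iF: "integrable (D \<Otimes>\<^sub>M N) F"
  proof (rule integrableI_nonneg)
    have "(\<integral>\<^sup>+ v. ennreal (b (fst v)) \<partial>D) < \<infinity>"
      using bD b0 by (simp add: nn_integral_eq_integral)
    thus "(\<integral>\<^sup>+ p. ennreal (F p) \<partial>(D \<Otimes>\<^sub>M N)) < \<infinity>" using nF by (rule le_less_trans[rotated])
  qed (use F0 in auto)
  have iF': "integrable M (\<lambda>w. F (?V w, R w))"
    using iF by (subst (asm) DNeq, subst (asm) integrable_distr_eq) auto
  thus sq: "square_integrable (\<lambda>w. K (A w) (R w))"
    unfolding square_integrable_def F_def by simp measurable
  have "expectation (\<lambda>w. F (?V w, R w)) = integral\<^sup>L (D \<Otimes>\<^sub>M N) F"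
    by (subst DNeq, subst integral_distr) auto
  also have "\<dots> = (LINT v|D. LINT z|N. F (v, z))"
    by (rule DN.integral_fst'[symmetric, OF iF])
  also have "\<dots> \<le> (LINT v|D. b (fst v))"
    using DN.integrable_fst'[OF iF] bD by (rule integral_mono) (simp add: F_def K2)
  also have "\<dots> = expectation (\<lambda>w. b (A w))"
    by (subst D, subst integral_distr) auto
  finally show "expectation (\<lambda>w. (norm (K (A w) (R w)))\<^sup>2) \<le> expectation (\<lambda>w. b (A w))"
    by (simp add: F_def)
  define H :: "('v \<times> 'v) \<times> 'z \<Rightarrow> real" where "H = (\<lambda>(v, z). snd v \<bullet> K (fst v) z)"
  have Hm [measurable]: "H \<in> borel_measurable (D \<Otimes>\<^sub>M N)" unfolding H_def by measurable
  \<comment> \<open>\<open>H\<close> has no sign, so Fubini's theorem needs its integrability, which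
    comes from the square integrability of both factors.\<close>
  have "integrable M (\<lambda>w. H (?V w, R w))"
    using square_integrable_inner[OF U sq] by (simp add: H_def)
  hence iH: "integrable (D \<Otimes>\<^sub>M N) H"
    by (subst DNeq, subst integrable_distr_eq) auto
  have "expectation (\<lambda>w. H (?V w, R w)) = integral\<^sup>L (D \<Otimes>\<^sub>M N) H"
    by (subst DNeq, subst integral_distr) auto
  also have "\<dots> = (LINT v|D. LINT z|N. H (v, z))"
    by (rule DN.integral_fst'[symmetric, OF iH])
  also have "\<dots> = 0" by (simp add: H_def K1)
  finally show "expectation (\<lambda>w. U w \<bullet> K (A w) (R w)) = 0" by (simp add: H_def)
qed

lemma square_integrable_vec:
  fixes E :: "'a \<Rightarrow> ('v::euclidean_space)^'n::finite"
  assumes "\<And>i. square_integrable (\<lambda>w. E w $ i)"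
  shows "square_integrable E"
proof -
  have m: "random_variable borel (\<lambda>w. E w $ i)" for i
    using assms by (simp add: square_integrable_def)
  have "random_variable borel E"
    by (rule borel_measurable_vec) (rule m)
  moreover have "(norm (E w))\<^sup>2 = (\<Sum>i\<in>UNIV. (norm (E w $ i))\<^sup>2)" for w
    by (simp add: power2_norm_eq_inner inner_vec_def)
  hence "integrable M (\<lambda>w. (norm (E w))\<^sup>2)"
    using assms by (simp add: square_integrable_def)
  ultimately show ?thesis by (simp add: square_integrable_def)
qed

text \<open>Rows are treated one at a time and summed, so the noise of different rows may be
  dependent. The bound \<open>s i + c * (norm x)\<^sup>2\<close> covers both kinds of noise: bounded
  variance for gradients (\<open>c = 0\<close>), error proportional to the argument for compression
  (\<open>s i = 0\<close>).\<close>

lemma independent_matrix_noise: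
  fixes K :: "'n::finite \<Rightarrow> real^'d \<Rightarrow> 'z \<Rightarrow> real^'d" and R :: "'a \<Rightarrow> 'n \<Rightarrow> 'z" and A U :: "'a \<Rightarrow> real^'d^'n"
  assumes ind: "\<And>i. independent_rv borel (\<lambda>w. (A w $ i, U w $ i)) (N i) (\<lambda>w. R w i)"
    and dR: "\<And>i. distr M (N i) (\<lambda>w. R w i) = N i"
    and K: "\<And>i. case_prod (K i) \<in> borel_measurable (borel \<Otimes>\<^sub>M N i)"
    and K1: "\<And>i x. integrable (N i) (K i x)" "\<And>i x. (LINT z|N i. K i x z) = 0"
    and K2: "\<And>i x. integrable (N i) (\<lambda>z. (norm (K i x z))\<^sup>2)"
      "\<And>i x. (LINT z|N i. (norm (K i x z))\<^sup>2) \<le> s i + c * (norm x)\<^sup>2"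
    and A: "square_integrable A" and U: "square_integrable U"
    and E: "\<And>w i. w \<in> space M \<Longrightarrow> E w $ i = K i (A w $ i) (R w i)"
  shows matrix_noise_square_integrable: "square_integrable E"
    and matrix_noise_second_moment:
      "expectation (\<lambda>w. (norm (E w))\<^sup>2) \<le> (\<Sum>i\<in>UNIV. s i) + c * expectation (\<lambda>w. (norm (A w))\<^sup>2)"
    and matrix_noise_centred: "expectation (\<lambda>w. U w \<bullet> E w) = 0"
proof -
  have sqA: "square_integrable (\<lambda>w. A w $ i)" and sqU: "square_integrable (\<lambda>w. U w $ i)" for i
    using A U by (auto intro: square_integrable_nth)
  hence iA: "integrable M (\<lambda>w. (norm (A w $ i))\<^sup>2)" for i
    by (simp add: square_integrable_def)
  hence bA: "integrable M (\<lambda>w. s i + c * (norm (A w $ i))\<^sup>2)" for i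
    by simp
  have sqK: "square_integrable (\<lambda>w. K i (A w $ i) (R w i))"
    and mom: "expectation (\<lambda>w. (norm (K i (A w $ i) (R w i)))\<^sup>2) \<le> expectation (\<lambda>w. s i + c * (norm (A w $ i))\<^sup>2)"
    and cen: "expectation (\<lambda>w. U w $ i \<bullet> K i (A w $ i) (R w i)) = 0" for i
    by (rule independent_noise[OF ind dR K K1 K2 _ bA sqU, of i]; measurable)+
  show "square_integrable E"
  proof (rule square_integrable_vec)
    show "square_integrable (\<lambda>w. E w $ i)" for i
      using sqK[of i] E unfolding square_integrable_def
      by (auto cong: measurable_cong Bochner_Integration.integrable_cong)
  qed
  have "expectation (\<lambda>w. (norm (E w))\<^sup>2) = expectation (\<lambda>w. \<Sum>i\<in>UNIV. (norm (K i (A w $ i) (R w i)))\<^sup>2)"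
    by (intro Bochner_Integration.integral_cong) (simp_all add: power2_norm_eq_inner inner_vec_def E)
  also have "\<dots> = (\<Sum>i\<in>UNIV. expectation (\<lambda>w. (norm (K i (A w $ i) (R w i)))\<^sup>2))"
    using sqK by (intro Bochner_Integration.integral_sum) (simp add: square_integrable_def)
  also have "\<dots> \<le> (\<Sum>i\<in>UNIV. expectation (\<lambda>w. s i + c * (norm (A w $ i))\<^sup>2))"
    by (intro sum_mono mom)
  also have "\<dots> = (\<Sum>i\<in>UNIV. s i) + c * expectation (\<lambda>w. \<Sum>i\<in>UNIV. (norm (A w $ i))\<^sup>2)"
    using iA by (simp add: sum.distrib sum_distrib_left prob_space)
  also have "(\<lambda>w. \<Sum>i\<in>UNIV. (norm (A w $ i))\<^sup>2) = (\<lambda>w. (norm (A w))\<^sup>2)"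
    by (simp add: power2_norm_eq_inner inner_vec_def)
  finally show "expectation (\<lambda>w. (norm (E w))\<^sup>2) \<le> (\<Sum>i\<in>UNIV. s i) + c * expectation (\<lambda>w. (norm (A w))\<^sup>2)" .
  have "expectation (\<lambda>w. U w \<bullet> E w) = expectation (\<lambda>w. \<Sum>i\<in>UNIV. U w $ i \<bullet> K i (A w $ i) (R w i))"
    by (intro Bochner_Integration.integral_cong) (simp_all add: inner_vec_def E)
  also have "\<dots> = (\<Sum>i\<in>UNIV. expectation (\<lambda>w. U w $ i \<bullet> K i (A w $ i) (R w i)))"
    by (intro Bochner_Integration.integral_sum square_integrable_inner sqU sqK)
  finally show "expectation (\<lambda>w. U w \<bullet> E w) = 0" by (simp add: cen)
qed

text \<open>Independent intersection-stable families generate independent sigma-algebras over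
  disjoint index blocks. The blocks \<open>J\<close>, the noise revealed so far, and
  \<open>{j}\<close>, the next noise vector, turn mutual independence into independence from the
  past.\<close>

lemma independent_rv_of_disjoint_sigma:
  assumes ind: "indep_sets \<F> I" and st: "\<And>i. i \<in> I \<Longrightarrow> Int_stable (\<F> i)"
    and J: "J \<subseteq> I" "j \<in> I" "j \<notin> J"
    and V: "V \<in> measurable (sigma (space M) (\<Union>i\<in>J. \<F> i)) N"
    and R: "R \<in> measurable (sigma (space M) (\<F> j)) N'"
  shows "independent_rv N V N' R"
proof -
  have ev: "\<F> i \<subseteq> events" if "i \<in> I" for i using ind that by (auto simp: indep_sets_def)
  hence sub: "(\<Union>i\<in>J. \<F> i) \<subseteq> Pow (space M)" "\<F> j \<subseteq> Pow (space M)"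
    using J sets.space_closed by blast+
  define T where "T = case_bool J {j}"
  have "indep_sets (\<lambda>b. sigma_sets (space M) (\<Union>i\<in>T b. \<F> i)) UNIV"
  proof (rule indep_sets_collect_sigma)
    show "indep_sets \<F> (\<Union>b\<in>UNIV. T b)"
      using ind by (rule indep_sets_mono_index[rotated]) (use J in \<open>auto simp: T_def split: bool.splits\<close>)
    show "Int_stable (\<F> i)" if "i \<in> T b" for i b
      using that J by (intro st) (auto simp: T_def split: bool.splits)
    show "disjoint_family_on T UNIV"
      using J by (auto simp: T_def disjoint_family_on_def split: bool.splits)
  qed
  hence ind2: "indep_set (sigma_sets (space M) (\<Union>i\<in>J. \<F> i)) (sigma_sets (space M) (\<F> j))"
    unfolding indep_set_def by (rule indep_sets_mono_sets) (auto simp: T_def split: bool.splits)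
  have 1: "{V -` X \<inter> space M |X. X \<in> sets N} \<subseteq> sigma_sets (space M) (\<Union>i\<in>J. \<F> i)"
    using measurable_sets[OF V] sub by (auto simp: space_measure_of)
  have 2: "{R -` X \<inter> space M |X. X \<in> sets N'} \<subseteq> sigma_sets (space M) (\<F> j)"
    using measurable_sets[OF R] sub by (auto simp: space_measure_of)
  have e1: "sigma_sets (space M) (\<Union>i\<in>J. \<F> i) \<subseteq> events" and e2: "sigma_sets (space M) (\<F> j) \<subseteq> events"
    using ind2 by (auto dest: indep_setD_ev1 indep_setD_ev2)
  have "random_variable N V" "random_variable N' R"
    using 1 2 e1 e2 measurable_space[OF V] measurable_space[OF R] sub
    by (auto intro!: measurableI simp: space_measure_of)
  moreover have "prob ((V -` X \<inter> space M) \<inter> (R -` Y \<inter> space M)) = prob (V -` X \<inter> space M) * prob (R -` Y \<inter> space M)"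
    if "X \<in> sets N" "Y \<in> sets N'" for X Y
    using that 1 2 by (intro indep_setD[OF ind2]) auto
  ultimately show ?thesis by (simp add: independent_rv_def)
qed

end

section \<open>Expected descent of the iteration\<close>

lemma matrix_mult_scaleR: "P ** (c *\<^sub>R X) = c *\<^sub>R (P ** X)" for P :: "real^'n^'m" and X :: "real^'d^'n"
  by (simp add: matrix_matrix_mult_def vec_eq_iff sum_distrib_left mult_ac)

lemma bounded_linear_matrix_mult: "bounded_linear (\<lambda>X::real^'d^'n. P ** X)" for P :: "real^'n^'m"
  by (subst linear_conv_bounded_linear[symmetric], rule linearI)
    (simp_all add: matrix_add_ldistrib matrix_mult_scaleR)

lemma measurable_subalgebra:
  assumes "sets F \<subseteq> sets F'" "space F = space F'" "V \<in> measurable F N"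
  shows "V \<in> measurable F' N"
  using assms by (auto simp: measurable_def)

lemma borel_measurable_bounded_linear:
  fixes T :: "'v::euclidean_space \<Rightarrow> 'u::euclidean_space"
  assumes "bounded_linear T" "V \<in> borel_measurable F"
  shows "(\<lambda>w. T (V w)) \<in> borel_measurable F"
  using assms by (intro measurable_compose[OF assms(2)] borel_measurable_continuous_onI linear_continuous_on)

locale lead = prob_space M + mixing Adj W
  for M :: "'w measure" and Adj :: "'n::finite \<Rightarrow> 'n \<Rightarrow> bool" and W :: "real^'n^'n" +
  fixes PX :: "'n \<Rightarrow> 'x measure" and PS :: "'s measure"
    and \<xi> :: "nat \<Rightarrow> 'w \<Rightarrow> 'n \<Rightarrow> 'x" and \<zeta> :: "nat \<Rightarrow> 'w \<Rightarrow> 'n \<Rightarrow> 's"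
    and f :: "'n \<Rightarrow> real^'d::finite \<Rightarrow> real" and g :: "'n \<Rightarrow> real^'d \<Rightarrow> real^'d"
    and G :: "'n \<Rightarrow> real^'d \<Rightarrow> 'x \<Rightarrow> real^'d" and Q :: "real^'d \<Rightarrow> 's \<Rightarrow> real^'d"
    and \<sigma> :: "'n \<Rightarrow> real" and xstar :: "real^'d"
    and X0 H1 Z :: "real^'d^'n" and X H D :: "nat \<Rightarrow> 'w \<Rightarrow> real^'d^'n"
    and L \<mu> \<eta> \<alpha> \<gamma> \<beta> C a1 \<rho> :: real
  assumes C: "C \<ge> 0" and Q: "unbiased_contracted C PS Q"
    and G: "\<And>i. unbiased_stoch_grad (PX i) (G i) (g i) (\<sigma> i)"
    and fresh: "fresh_noise M PX PS \<xi> \<zeta>"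
    and \<mu>: "\<mu> > 0" "\<mu> \<le> L" and f: "\<And>i. smooth_strongly_convex \<mu> L (f i) (g i)"
    and xstar: "\<And>x. (\<Sum>i\<in>UNIV. f i xstar) \<le> (\<Sum>i\<in>UNIV. f i x)"
    and path: "\<And>\<omega>. \<omega> \<in> space M \<Longrightarrow>
           lead_path W \<eta> \<alpha> \<gamma>
             (\<lambda>k A. stoch_grad_matrix G A (\<xi> k \<omega>)) (\<lambda>k A. compress Q A (\<zeta> k \<omega>))
             X0 H1 Z (\<lambda>k. X k \<omega>) (\<lambda>k. H k \<omega>) (\<lambda>k. D k \<omega>)"
    and \<beta>: "\<beta> = lambda_max (mat 1 - W)"
    and a1: "a1 = 4 * (1 + C) / (C * \<beta> * \<gamma> + 2)"
    and \<rho>: "\<rho> = lead_rate W \<mu> \<eta> \<alpha> \<gamma> a1"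
    and \<eta>: "\<eta> \<in> {0<..2 / (\<mu> + L)}"
    and \<gamma>: "\<gamma> \<in> {0<..<gamma_bound C \<beta> \<mu> \<eta>}"
    and \<alpha>: "\<alpha> \<in> {C * \<beta> * \<gamma> / (2 * (1 + C)) ..
               1 / a1 * min ((2 - \<beta> * \<gamma>) / (4 - \<beta> * \<gamma>)) (\<mu> * \<eta> * (2 - \<mu> * \<eta>))}"
begin

section \<open>Information generated by the noise, and adapted processes\<close>

text \<open>\<open>Inl k\<close> stands for the samples of iteration \<open>k\<close> and
  \<open>Inr k\<close> for its compression seeds. One index type holds both, so its subsets describe
  how much noise has been revealed.\<close>

definition noise_sets :: "nat + nat \<Rightarrow> 'w set set" where
  "noise_sets = case_sum (\<lambda>k. sets (vimage_algebra (space M) (\<xi> k) (PiM UNIV PX)))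
                 (\<lambda>k. sets (vimage_algebra (space M) (\<zeta> k) (PiM UNIV (\<lambda>_. PS))))"

abbreviation all_noise :: "(nat + nat) set" where
  "all_noise \<equiv> UNIV <+> {1..}"

definition generated :: "(nat + nat) set \<Rightarrow> 'w measure" where
  "generated J = sigma (space M) (\<Union>j\<in>J. noise_sets j)"

lemma noise_sets_closed: "noise_sets j \<subseteq> Pow (space M)"
proof (cases j)
  case (Inl k)
  thus ?thesis using sets.space_closed[of "vimage_algebra (space M) (\<xi> k) (PiM UNIV PX)"]
    by (simp add: noise_sets_def)
next
  case (Inr k)
  thus ?thesis using sets.space_closed[of "vimage_algebra (space M) (\<zeta> k) (PiM UNIV (\<lambda>_. PS))"]
    by (simp add: noise_sets_def)
qed

lemma noise_sets_closed': "(\<Union>j\<in>J. noise_sets j) \<subseteq> Pow (space M)"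
  using noise_sets_closed by blast

lemma space_generated [simp]: "space (generated J) = space M"
  using noise_sets_closed' by (simp add: generated_def space_measure_of)

lemma sets_generated: "sets (generated J) = sigma_sets (space M) (\<Union>j\<in>J. noise_sets j)"
  using noise_sets_closed' by (simp add: generated_def)

lemma noise_indep: "indep_sets noise_sets all_noise"
  using fresh by (simp add: fresh_noise_def noise_sets_def)

lemma measurable_generated_mono:
  assumes "J \<subseteq> J'" "V \<in> measurable (generated J) N"
  shows "V \<in> measurable (generated J') N"
  using assms by (intro measurable_subalgebra[OF _ _ assms(2)])
    (auto simp: sets_generated intro!: sigma_sets_mono')

lemma sample_measurable:
  assumes "Inl k \<in> J"
  shows "(\<lambda>w. \<xi> k w i) \<in> measurable (generated J) (PX i)"
proof -
  have "\<xi> k \<in> measurable M (PiM UNIV PX)" using fresh by (simp add: fresh_noise_def)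
  hence "\<xi> k \<in> measurable (vimage_algebra (space M) (\<xi> k) (PiM UNIV PX)) (PiM UNIV PX)"
    by (intro measurable_vimage_algebra1) (auto dest: measurable_space)
  hence "\<xi> k \<in> measurable (generated {Inl k}) (PiM UNIV PX)"
    by (rule measurable_subalgebra[rotated 2])
      (auto simp: sets_generated noise_sets_def)
  hence "\<xi> k \<in> measurable (generated J) (PiM UNIV PX)"
    by (rule measurable_generated_mono[rotated]) (use assms in auto)
  thus ?thesis by (rule measurable_compose) simp
qed

lemma seed_measurable:
  assumes "Inr k \<in> J" "1 \<le> k"
  shows "(\<lambda>w. \<zeta> k w i) \<in> measurable (generated J) PS"
proof -
  have "\<zeta> k \<in> measurable M (PiM UNIV (\<lambda>_. PS))" using fresh assms by (simp add: fresh_noise_def)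
  hence "\<zeta> k \<in> measurable (vimage_algebra (space M) (\<zeta> k) (PiM UNIV (\<lambda>_. PS))) (PiM UNIV (\<lambda>_. PS))"
    by (intro measurable_vimage_algebra1) (auto dest: measurable_space)
  hence "\<zeta> k \<in> measurable (generated {Inr k}) (PiM UNIV (\<lambda>_. PS))"
    by (rule measurable_subalgebra[rotated 2])
      (auto simp: sets_generated noise_sets_def)
  hence "\<zeta> k \<in> measurable (generated J) (PiM UNIV (\<lambda>_. PS))"
    by (rule measurable_generated_mono[rotated]) (use assms in auto)
  thus ?thesis by (rule measurable_compose) simp
qed

lemma sample_distr: "distr M (PX i) (\<lambda>w. \<xi> k w i) = PX i"
  and seed_distr: "1 \<le> k \<Longrightarrow> distr M PS (\<lambda>w. \<zeta> k w i) = PS"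
  using fresh by (auto simp: fresh_noise_def)

lemma independent_of_generated:
  assumes "J \<subseteq> all_noise" "j \<in> all_noise" "j \<notin> J"
    and "V \<in> measurable (generated J) N" "R \<in> measurable (generated {j}) N'"
  shows "independent_rv N V N' R"
proof (rule independent_rv_of_disjoint_sigma[OF noise_indep _ assms(1,2,3)])
  show "Int_stable (noise_sets i)" for i
    by (cases i) (simp_all add: noise_sets_def sets.Int_stable)
qed (use assms(4,5) in \<open>simp_all add: generated_def\<close>)

text \<open>Measurability with respect to the revealed noise gives independence of later noise,
  square integrability gives finite expectations; the iterates need both, and the same operations
  preserve both.\<close>

definition adapted :: "(nat + nat) set \<Rightarrow> ('w \<Rightarrow> real^'d^'n) \<Rightarrow> bool" where
  "adapted J V \<longleftrightarrow> V \<in> borel_measurable (generated J) \<and> square_integrable V"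

lemma adapted_add: "adapted J U \<Longrightarrow> adapted J V \<Longrightarrow> adapted J (\<lambda>w. U w + V w)"
  unfolding adapted_def by (auto intro: square_integrable_add)

lemma adapted_diff: "adapted J U \<Longrightarrow> adapted J V \<Longrightarrow> adapted J (\<lambda>w. U w - V w)"
  unfolding adapted_def by (auto intro: square_integrable_diff)

lemma adapted_scaleR: "adapted J U \<Longrightarrow> adapted J (\<lambda>w. c *\<^sub>R U w)"
  unfolding adapted_def by (auto intro: square_integrable_scaleR)

lemma adapted_const: "adapted J (\<lambda>w. c)"
  unfolding adapted_def by (auto intro: square_integrable_const)

lemma adapted_mult: "adapted J U \<Longrightarrow> adapted J (\<lambda>w. P ** U w)"
  unfolding adapted_def
  using bounded_linear_matrix_mult borel_measurable_bounded_linear square_integrable_bounded_linear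
  by blast

lemma adapted_mono: "adapted J U \<Longrightarrow> J \<subseteq> J' \<Longrightarrow> adapted J' U"
  unfolding adapted_def using measurable_generated_mono by blast

text \<open>The recursion is known only on \<open>space M\<close>, so adaptedness has to be
  transferred between functions that agree there.\<close>

lemma adapted_cong:
  assumes "\<And>w. w \<in> space M \<Longrightarrow> U w = V w"
  shows "adapted J U \<longleftrightarrow> adapted J V"
proof -
  have "U \<in> borel_measurable F \<longleftrightarrow> V \<in> borel_measurable F" if "space F = space M" for F
    using assms that by (intro measurable_cong) simp
  moreover have "integrable M (\<lambda>w. (norm (U w))\<^sup>2) \<longleftrightarrow> integrable M (\<lambda>w. (norm (V w))\<^sup>2)"
    using assms by (intro Bochner_Integration.integrable_cong) simp_all
  ultimately show ?thesis by (simp add: adapted_def square_integrable_def)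
qed

lemmas adapted_intros = adapted_add adapted_diff adapted_scaleR adapted_const adapted_mult

lemma adapted_nth: "adapted J U \<Longrightarrow> (\<lambda>w. U w $ i) \<in> borel_measurable (generated J)"
  unfolding adapted_def by (auto intro: borel_measurable_bounded_linear[OF bounded_linear_vec_nth])

lemma adapted_pair:
  assumes "adapted J U" "adapted J V"
  shows "(\<lambda>w. (U w $ i, V w $ i)) \<in> borel_measurable (generated J)"
  using adapted_nth[OF assms(1), of i] adapted_nth[OF assms(2), of i] by measurable

text \<open>\<open>g i\<close> is the partial integral of a jointly measurable function over the
  sample.\<close>

lemma gradient_measurable: "g i \<in> borel_measurable borel"
proof -
  have m: "case_prod (G i) \<in> borel_measurable (borel \<Otimes>\<^sub>M PX i)" and p: "prob_space (PX i)"
    and e: "g i = (\<lambda>x. LINT z|PX i. G i x z)"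
    using G[of i] by (auto simp: unbiased_stoch_grad_def)
  interpret P: prob_space "PX i" by (rule p)
  show ?thesis unfolding e using m by (rule P.borel_measurable_lebesgue_integral)
qed

lemma adapted_grad_matrix:
  assumes V: "adapted J V"
  shows "adapted J (\<lambda>w. grad_matrix g (V w))"
proof -
  have nth: "grad_matrix g (V w) $ i = g i (V w $ i)" for w i by (simp add: grad_matrix_def)
  have sV: "square_integrable (\<lambda>w. V w $ i)" for i
    using V by (auto simp: adapted_def intro: square_integrable_nth)
  have "square_integrable (\<lambda>w. g i (V w $ i))" for i
  proof -
    have [measurable]: "random_variable borel (\<lambda>w. V w $ i)"
      using sV by (simp add: square_integrable_def)
    note [measurable] = gradient_measurable[of i]
    have "square_integrable (\<lambda>w. g i (V w $ i) - g i 0)"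
      by (rule square_integrable_bound[OF sV[of i], where c = "\<mu> + L"])
        (use gradient_lipschitz[OF f \<mu>, of i _ 0] in auto)
    from square_integrable_add[OF this square_integrable_const[of "g i 0"]] show ?thesis by simp
  qed
  moreover have "(\<lambda>w. grad_matrix g (V w)) \<in> borel_measurable (generated J)"
    by (rule borel_measurable_vec)
      (simp add: nth measurable_compose[OF adapted_nth[OF V] gradient_measurable])
  ultimately show ?thesis
    using square_integrable_vec[of "\<lambda>w. grad_matrix g (V w)"] by (simp add: adapted_def nth)
qed

section \<open>Gradient noise and compression noise\<close>

definition grad_noise :: "nat \<Rightarrow> ('w \<Rightarrow> real^'d^'n) \<Rightarrow> 'w \<Rightarrow> real^'d^'n" where
  "grad_noise k V w = stoch_grad_matrix G (V w) (\<xi> k w) - grad_matrix g (V w)"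

text \<open>The current sample \<open>Inl k\<close> lies outside \<open>J\<close>, hence is
  independent of the argument \<open>V\<close> and of the test matrix \<open>U\<close>.\<close>

lemma grad_noise_props:
  assumes V: "adapted J V" and J: "J \<subseteq> all_noise" "Inl k \<notin> J"
  shows adapted_grad_noise: "adapted (insert (Inl k) J) (grad_noise k V)"
    and grad_noise_second_moment: "expectation (\<lambda>w. (norm (grad_noise k V w))\<^sup>2) \<le> (\<Sum>i\<in>UNIV. (\<sigma> i)\<^sup>2)"
    and grad_noise_centred: "adapted J U \<Longrightarrow> expectation (\<lambda>w. U w \<bullet> grad_noise k V w) = 0"
proof -
  have G': "prob_space (PX i)" "case_prod (G i) \<in> borel_measurable (borel \<Otimes>\<^sub>M PX i)"
    "integrable (PX i) (G i x)" "(LINT z|PX i. G i x z) = g i x"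
    "integrable (PX i) (\<lambda>z. (norm (G i x z - g i x))\<^sup>2)"
    "(LINT z|PX i. (norm (G i x z - g i x))\<^sup>2) \<le> (\<sigma> i)\<^sup>2" for i x
    using G[of i] by (auto simp: unbiased_stoch_grad_def)
  define K where "K = (\<lambda>i x z. G i x z - g i x)"
  have mK: "case_prod (K i) \<in> borel_measurable (borel \<Otimes>\<^sub>M PX i)" for i
  proof -
    note [measurable] = gradient_measurable[of i] G'(2)[of i]
    show ?thesis unfolding K_def by measurable
  qed
  have cen: "integrable (PX i) (K i x)" "(LINT z|PX i. K i x z) = 0" for i x
  proof -
    interpret P: prob_space "PX i" by (rule G')
    show "integrable (PX i) (K i x)" "(LINT z|PX i. K i x z) = 0"
      using G'(3,4)[of i x] by (simp_all add: K_def P.prob_space)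
  qed
  have nth: "grad_noise k V w $ i = K i (V w $ i) (\<xi> k w i)" for w i
    by (simp add: grad_noise_def stoch_grad_matrix_def grad_matrix_def K_def)
  have s: "adapted J U \<Longrightarrow> square_integrable U" for U by (simp add: adapted_def)
  have ind: "independent_rv borel (\<lambda>w. (V w $ i, U w $ i)) (PX i) (\<lambda>w. \<xi> k w i)"
    if "adapted J U" for U i
    using J by (intro independent_of_generated[OF _ _ _ adapted_pair[OF V that] sample_measurable]) auto
  have K2: "integrable (PX i) (\<lambda>z. (norm (K i x z))\<^sup>2)" for i x
    using G'(5) by (simp add: K_def)
  have K3: "(LINT z|PX i. (norm (K i x z))\<^sup>2) \<le> (\<sigma> i)\<^sup>2 + 0 * (norm x)\<^sup>2" for i x
    using G'(6) by (simp add: K_def)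
  show cU: "expectation (\<lambda>w. U w \<bullet> grad_noise k V w) = 0" if "adapted J U" for U
    using that by (intro matrix_noise_centred[OF ind sample_distr mK cen K2 K3 s[OF V] s nth])
  have sq: "square_integrable (grad_noise k V)"
    using V by (intro matrix_noise_square_integrable[OF ind sample_distr mK cen K2 K3 s[OF V] s nth])
  have "expectation (\<lambda>w. (norm (grad_noise k V w))\<^sup>2) \<le> (\<Sum>i\<in>UNIV. (\<sigma> i)\<^sup>2) + 0 * expectation (\<lambda>w. (norm (V w))\<^sup>2)"
    using V by (intro matrix_noise_second_moment[OF ind sample_distr mK cen K2 K3 s[OF V] s nth])
  thus "expectation (\<lambda>w. (norm (grad_noise k V w))\<^sup>2) \<le> (\<Sum>i\<in>UNIV. (\<sigma> i)\<^sup>2)" by simp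
  have "grad_noise k V \<in> borel_measurable (generated (insert (Inl k) J))"
  proof (rule borel_measurable_vec)
    fix i
    have [measurable]: "(\<lambda>w. V w $ i) \<in> borel_measurable (generated (insert (Inl k) J))"
      by (rule adapted_nth[OF adapted_mono[OF V]]) auto
    have [measurable]: "(\<lambda>w. \<xi> k w i) \<in> measurable (generated (insert (Inl k) J)) (PX i)"
      by (rule sample_measurable) simp
    note mK[of i, measurable]
    have "(\<lambda>w. case_prod (K i) (V w $ i, \<xi> k w i)) \<in> borel_measurable (generated (insert (Inl k) J))"
      by measurable
    thus "(\<lambda>w. grad_noise k V w $ i) \<in> borel_measurable (generated (insert (Inl k) J))"
      by (simp add: nth)
  qed
  thus "adapted (insert (Inl k) J) (grad_noise k V)" using sq by (simp add: adapted_def)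
qed

definition compress_noise :: "nat \<Rightarrow> ('w \<Rightarrow> real^'d^'n) \<Rightarrow> 'w \<Rightarrow> real^'d^'n" where
  "compress_noise k V w = compress Q (V w) (\<zeta> k w) - V w"

text \<open>Here the second moment scales with the argument. \<open>J\<close> may already contain
  \<open>Inl k\<close>: the seed is drawn after the sample of the same iteration.\<close>

lemma compress_noise_props:
  assumes V: "adapted J V" and J: "J \<subseteq> all_noise" "Inr k \<notin> J" and k: "1 \<le> k"
  shows adapted_compress_noise: "adapted (insert (Inr k) J) (compress_noise k V)"
    and compress_noise_second_moment:
      "expectation (\<lambda>w. (norm (compress_noise k V w))\<^sup>2) \<le> C * expectation (\<lambda>w. (norm (V w))\<^sup>2)"
    and compress_noise_centred: "adapted J U \<Longrightarrow> expectation (\<lambda>w. U w \<bullet> compress_noise k V w) = 0"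
proof -
  have Q': "prob_space PS" "case_prod Q \<in> borel_measurable (borel \<Otimes>\<^sub>M PS)"
    "integrable PS (Q x)" "(LINT z|PS. Q x z) = x"
    "integrable PS (\<lambda>z. (norm (x - Q x z))\<^sup>2)"
    "(LINT z|PS. (norm (x - Q x z))\<^sup>2) \<le> C * (norm x)\<^sup>2" for x
    using Q by (auto simp: unbiased_contracted_def)
  define K where "K = (\<lambda>(i::'n) x z. Q x z - x)"
  have mK: "case_prod (K i) \<in> borel_measurable (borel \<Otimes>\<^sub>M PS)" for i
  proof -
    note [measurable] = Q'(2)
    show ?thesis unfolding K_def by measurable
  qed
  have cen: "integrable PS (K i x)" "(LINT z|PS. K i x z) = 0" for i x
  proof -
    interpret P: prob_space PS by (rule Q')
    show "integrable PS (K i x)" "(LINT z|PS. K i x z) = 0"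
      using Q'(3,4)[of x] by (simp_all add: K_def P.prob_space)
  qed
  have nth: "compress_noise k V w $ i = K i (V w $ i) (\<zeta> k w i)" for w i
    by (simp add: compress_noise_def compress_def K_def)
  have s: "adapted J U \<Longrightarrow> square_integrable U" for U by (simp add: adapted_def)
  have ind: "independent_rv borel (\<lambda>w. (V w $ i, U w $ i)) PS (\<lambda>w. \<zeta> k w i)"
    if "adapted J U" for U i
    using J k by (intro independent_of_generated[OF _ _ _ adapted_pair[OF V that] seed_measurable]) auto
  have K2: "integrable PS (\<lambda>z. (norm (K i x z))\<^sup>2)" for i x
    using Q'(5) by (simp add: K_def norm_minus_commute)
  have K3: "(LINT z|PS. (norm (K i x z))\<^sup>2) \<le> 0 + C * (norm x)\<^sup>2" for i x
    using Q'(6) by (simp add: K_def norm_minus_commute)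
  show cU: "expectation (\<lambda>w. U w \<bullet> compress_noise k V w) = 0" if "adapted J U" for U
    using that by (intro matrix_noise_centred[OF ind seed_distr[OF k] mK cen K2 K3 s[OF V] s nth])
  have sq: "square_integrable (compress_noise k V)"
    using V by (intro matrix_noise_square_integrable[OF ind seed_distr[OF k] mK cen K2 K3 s[OF V] s nth])
  have "expectation (\<lambda>w. (norm (compress_noise k V w))\<^sup>2) \<le> (\<Sum>i\<in>(UNIV::'n set). 0) + C * expectation (\<lambda>w. (norm (V w))\<^sup>2)"
    using V by (intro matrix_noise_second_moment[OF ind seed_distr[OF k] mK cen K2 K3 s[OF V] s nth])
  thus "expectation (\<lambda>w. (norm (compress_noise k V w))\<^sup>2) \<le> C * expectation (\<lambda>w. (norm (V w))\<^sup>2)" by simp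
  have "compress_noise k V \<in> borel_measurable (generated (insert (Inr k) J))"
  proof (rule borel_measurable_vec)
    fix i
    have [measurable]: "(\<lambda>w. V w $ i) \<in> borel_measurable (generated (insert (Inr k) J))"
      by (rule adapted_nth[OF adapted_mono[OF V]]) auto
    have [measurable]: "(\<lambda>w. \<zeta> k w i) \<in> measurable (generated (insert (Inr k) J)) PS"
      by (rule seed_measurable) (use k in simp_all)
    note mK[of i, measurable]
    have "(\<lambda>w. case_prod (K i) (V w $ i, \<zeta> k w i)) \<in> borel_measurable (generated (insert (Inr k) J))"
      by measurable
    thus "(\<lambda>w. compress_noise k V w $ i) \<in> borel_measurable (generated (insert (Inr k) J))"
      by (simp add: nth)
  qed
  thus "adapted (insert (Inr k) J) (compress_noise k V)" using sq by (simp add: adapted_def)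
qed

(* The indices of the noise that determines the iterates X k, H k and D k; there is no seed 0. *)
definition past :: "nat \<Rightarrow> (nat + nat) set" where
  "past k = {..<k} <+> {1..<k}"

text \<open>Iteration \<open>k\<close> first reveals \<open>Inl k\<close> and then
  \<open>Inr k\<close>; these are the side conditions of the two noise steps.\<close>

lemma past_simps: "past k \<subseteq> all_noise" "Inl k \<notin> past k" "Inr k \<notin> insert (Inl k) (past k)"
  "1 \<le> k \<Longrightarrow> insert (Inr k) (insert (Inl k) (past k)) = past (Suc k)"
  "1 \<le> k \<Longrightarrow> insert (Inl k) (past k) \<subseteq> all_noise"
  by (auto simp: past_def Plus_def lessThan_Suc atLeastLessThanSuc)

definition "Y k w = X k w - \<eta> *\<^sub>R stoch_grad_matrix G (X k w) (\<xi> k w) - \<eta> *\<^sub>R D k w"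
definition "N k = grad_noise k (X k)"
definition "E k = compress_noise k (\<lambda>w. Y k w - H k w)"

lemma initial:
  assumes "w \<in> space M"
  shows "H 1 w = H1" "D 1 w = A ** Z" "X 1 w = X0 - \<eta> *\<^sub>R stoch_grad_matrix G X0 (\<xi> 0 w)"
  using path[OF assms] by (auto simp: lead_path_def A_def)

lemma iterate:
  assumes "w \<in> space M" "1 \<le> k"
  shows "H (Suc k) w = (1 - \<alpha>) *\<^sub>R H k w + \<alpha> *\<^sub>R (Y k w + E k w)"
    "D (Suc k) w = D k w + (\<gamma> / (2 * \<eta>)) *\<^sub>R (A ** (Y k w + E k w))"
    "X (Suc k) w = Y k w + \<eta> *\<^sub>R D k w - \<eta> *\<^sub>R D (Suc k) w"
proof -
  have e: "H k w + compress Q (Y k w - H k w) (\<zeta> k w) = Y k w + E k w"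
    by (simp add: E_def compress_noise_def)
  show "H (Suc k) w = (1 - \<alpha>) *\<^sub>R H k w + \<alpha> *\<^sub>R (Y k w + E k w)"
    "D (Suc k) w = D k w + (\<gamma> / (2 * \<eta>)) *\<^sub>R (A ** (Y k w + E k w))"
    "X (Suc k) w = Y k w + \<eta> *\<^sub>R D k w - \<eta> *\<^sub>R D (Suc k) w"
    unfolding e[symmetric] using path[OF assms(1)] assms(2)
    by (simp_all add: lead_path_def A_def Let_def Y_def)
qed

lemma adapted_Y:
  assumes "adapted (past k) (X k)" "adapted (past k) (D k)"
  shows "adapted (insert (Inl k) (past k)) (Y k)"
proof -
  have Y: "Y k = (\<lambda>w. X k w - \<eta> *\<^sub>R (N k w + grad_matrix g (X k w)) - \<eta> *\<^sub>R D k w)"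
    by (auto simp: fun_eq_iff Y_def N_def grad_noise_def)
  have m: "adapted (past k) V \<Longrightarrow> adapted (insert (Inl k) (past k)) V" for V
    by (erule adapted_mono) auto
  show ?thesis unfolding Y N_def
    by (intro adapted_intros adapted_grad_noise adapted_grad_matrix m assms past_simps)
qed

lemma adapted_E:
  assumes "1 \<le> k" "adapted (past k) (X k)" "adapted (past k) (H k)" "adapted (past k) (D k)"
  shows "adapted (past (Suc k)) (E k)"
proof -
  have "adapted (insert (Inl k) (past k)) (\<lambda>w. Y k w - H k w)"
    using adapted_mono[OF assms(3)] by (intro adapted_intros adapted_Y assms) auto
  from adapted_compress_noise[OF this past_simps(5)[OF assms(1)] past_simps(3) assms(1)] show ?thesis
    unfolding E_def past_simps(4)[OF assms(1)] .
qed

text \<open>Square integrability starts from the constants \<open>X0\<close>, \<open>H1\<close> and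
  \<open>Z\<close> and survives each step because the exact gradients are Lipschitz and both noises
  have finite second moments.\<close>

lemma adapted_iterates:
  assumes "1 \<le> k"
  shows "adapted (past k) (X k) \<and> adapted (past k) (H k) \<and> adapted (past k) (D k)"
  using assms
proof (induction k rule: dec_induct)
  case base
  have p: "past 1 = insert (Inl 0) {}" by (auto simp: past_def Plus_def)
  have X1: "X 1 w = X0 - \<eta> *\<^sub>R (grad_noise 0 (\<lambda>_. X0) w + grad_matrix g X0)" if "w \<in> space M" for w
    using initial(3)[OF that] by (simp add: grad_noise_def)
  have "adapted (past 1) (grad_noise 0 (\<lambda>_. X0))"
    unfolding p by (rule adapted_grad_noise[OF adapted_const]) simp_all
  hence "adapted (past 1) (\<lambda>w. X0 - \<eta> *\<^sub>R (grad_noise 0 (\<lambda>_. X0) w + grad_matrix g X0))"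
    by (intro adapted_intros)
  hence "adapted (past 1) (X 1)" by (rule adapted_cong[THEN iffD2, rotated]) (rule X1)
  moreover have "adapted (past 1) (H 1)"
    using adapted_const by (rule adapted_cong[THEN iffD2, rotated]) (rule initial(1))
  moreover have "adapted (past 1) (D 1)"
    using adapted_const by (rule adapted_cong[THEN iffD2, rotated]) (rule initial(2))
  ultimately show ?case by simp
next
  case (step k)
  hence X: "adapted (past k) (X k)" and H: "adapted (past k) (H k)" and D: "adapted (past k) (D k)"
    by auto
  have m: "adapted (past k) V \<Longrightarrow> adapted (past (Suc k)) V" for V
    by (erule adapted_mono) (auto simp: past_def)
  have Y: "adapted (past (Suc k)) (Y k)"
    using adapted_Y[OF X D] past_simps(4)[OF step(1)] by (auto elim: adapted_mono)
  have E: "adapted (past (Suc k)) (E k)" using step(1) X H D by (rule adapted_E)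
  have D': "adapted (past (Suc k)) (\<lambda>w. D k w + (\<gamma> / (2 * \<eta>)) *\<^sub>R (A ** (Y k w + E k w)))"
    by (intro adapted_intros m[OF D] Y E)
  hence D'': "adapted (past (Suc k)) (D (Suc k))"
    by (rule adapted_cong[THEN iffD2, rotated]) (rule iterate(2)[OF _ \<open>1 \<le> k\<close>])
  moreover have "adapted (past (Suc k)) (\<lambda>w. (1 - \<alpha>) *\<^sub>R H k w + \<alpha> *\<^sub>R (Y k w + E k w))"
    by (intro adapted_intros m[OF H] Y E)
  hence "adapted (past (Suc k)) (H (Suc k))"
    by (rule adapted_cong[THEN iffD2, rotated]) (rule iterate(1)[OF _ \<open>1 \<le> k\<close>])
  moreover have "adapted (past (Suc k)) (\<lambda>w. Y k w + \<eta> *\<^sub>R D k w - \<eta> *\<^sub>R D (Suc k) w)"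
    by (intro adapted_intros m[OF D] D'' Y)
  hence "adapted (past (Suc k)) (X (Suc k))"
    by (rule adapted_cong[THEN iffD2, rotated]) (rule iterate(3)[OF _ \<open>1 \<le> k\<close>])
  ultimately show ?case by simp
qed

section \<open>Constants of the descent inequality and their signs\<close>

definition "Xs = consensus xstar"
definition "Gs = grad_matrix g Xs"
text \<open>The relative decrease of the squared distance in an exact gradient step;
  \<open>1 - p = (1 - \<mu> * \<eta>)\<^sup>2\<close>.\<close>

definition "p = \<mu> * \<eta> * (2 - \<mu> * \<eta>)"
definition "b = a1 * \<alpha>"
definition "\<kappa> = (1 - b) * (\<gamma>\<^sup>2 / 4) * \<beta>\<^sup>2 + \<gamma> / 2 * \<beta> + a1 * \<alpha>\<^sup>2"
definition "Lyap k w = lead_lyapunov W \<eta> \<alpha> \<gamma> a1 Xs (- Gs) (X k w) (H k w) (D k w)"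

lemma beta_eq: "\<beta> = lambda_max A"
  by (simp add: \<beta> A_def)

lemma gamma_less: "\<gamma> < 2 / ((3 * C + 1) * \<beta>)"
  using \<gamma> by (auto simp: gamma_bound_def split: if_splits)

lemma positive: "0 < \<beta>" "0 < \<eta>" "0 < \<gamma>" "0 < a1" "0 \<le> \<alpha>" "0 < p" "p \<le> 1"
proof -
  show \<gamma>0: "0 < \<gamma>" and \<eta>0: "0 < \<eta>" using \<gamma> \<eta> by auto
  \<comment> \<open>Division by zero yields \<open>0\<close>, so \<open>\<beta> = 0\<close> would
    turn \<open>gamma_less\<close> into \<open>\<gamma> < 0\<close>.\<close>
  have "\<beta> \<noteq> 0" using gamma_less \<gamma>0 by auto
  thus \<beta>0: "0 < \<beta>" using lambda_max_A_nonneg beta_eq by simp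
  have "0 < C * \<beta> * \<gamma> + 2" using C \<beta>0 \<gamma>0 by (simp add: add_nonneg_pos)
  thus "0 < a1" using C by (simp add: a1)
  have "0 \<le> C * \<beta> * \<gamma> / (2 * (1 + C))" using C \<beta>0 \<gamma>0 by simp
  thus "0 \<le> \<alpha>" using \<alpha> by auto
  have "\<eta> * (\<mu> + L) \<le> 2" using \<eta> \<mu> by (simp add: field_simps)
  moreover have "\<eta> * (2 * \<mu>) \<le> \<eta> * (\<mu> + L)" using \<mu> \<eta>0 by (intro mult_left_mono) auto
  ultimately have "\<mu> * \<eta> \<le> 1" by (simp add: mult_ac)
  moreover have "0 < \<mu> * \<eta>" using \<mu> \<eta>0 by simp
  ultimately show "0 < p" by (simp add: p_def)
  have "1 - p = (1 - \<mu> * \<eta>)\<^sup>2" by (simp add: p_def power2_eq_square algebra_simps)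
  thus "p \<le> 1" using zero_le_power2[of "1 - \<mu> * \<eta>"] by linarith
qed

lemma t_bound: "0 < \<beta> * \<gamma>" "(3 * C + 1) * (\<beta> * \<gamma>) < 2" "\<beta> * \<gamma> < 2"
proof -
  show t0: "0 < \<beta> * \<gamma>" using positive by simp
  have "0 < (3 * C + 1) * \<beta>" using C positive by (simp add: add_nonneg_pos)
  hence "\<gamma> * ((3 * C + 1) * \<beta>) < 2" using gamma_less by (simp add: pos_less_divide_eq)
  thus t: "(3 * C + 1) * (\<beta> * \<gamma>) < 2" by (simp add: mult_ac)
  have "0 \<le> C * (\<beta> * \<gamma>)" using C t0 by simp
  thus "\<beta> * \<gamma> < 2" using t by (simp add: algebra_simps)
qed

lemma b_bounds: "b \<le> (2 - \<beta> * \<gamma>) / (4 - \<beta> * \<gamma>)" "b \<le> p" "b < 1"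
proof -
  have "\<alpha> \<le> 1 / a1 * min ((2 - \<beta> * \<gamma>) / (4 - \<beta> * \<gamma>)) p" using \<alpha> by (simp add: p_def)
  hence "b \<le> a1 * (1 / a1 * min ((2 - \<beta> * \<gamma>) / (4 - \<beta> * \<gamma>)) p)"
    unfolding b_def using positive by (intro mult_left_mono) auto
  hence b: "b \<le> min ((2 - \<beta> * \<gamma>) / (4 - \<beta> * \<gamma>)) p" using positive by simp
  thus 1: "b \<le> (2 - \<beta> * \<gamma>) / (4 - \<beta> * \<gamma>)" and "b \<le> p" by auto
  have "(2 - \<beta> * \<gamma>) / (4 - \<beta> * \<gamma>) < 1" using t_bound by simp
  thus "b < 1" using 1 by linarith
qed

lemma kappa_le: "C * \<kappa> \<le> a1 * \<alpha> * (1 - \<alpha>)"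
  unfolding \<kappa>_def b_def
  by (rule compression_parameters[OF C t_bound(1,2) a1]) (use \<alpha> b_bounds in \<open>auto simp: b_def\<close>)

lemma kappa_nonneg: "0 \<le> \<kappa>"
  using b_bounds positive by (simp add: \<kappa>_def)

lemma lambda_max_B: "0 < lambda_max B"
  by (rule lambda_max_B_pos) (use positive beta_eq in simp)

text \<open>The second entry of the maximum is always below 1. The other two reach 1 at
  \<open>b = p\<close> and at \<open>\<alpha> = 0\<close>, which is why the strict bound needs both
  conditions.\<close>

lemma rate_ge: "(1 - p) / (1 - b) \<le> \<rho>" "1 - \<gamma> / (2 * lambda_max B) \<le> \<rho>" "1 - \<alpha> \<le> \<rho>"
  and rate_le: "\<rho> \<le> 1"
  and rate_less: "0 < \<alpha> \<Longrightarrow> b < p \<Longrightarrow> \<rho> < 1"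
proof -
  have r: "\<rho> = Max {(1 - p) / (1 - b), 1 - \<gamma> / (2 * lambda_max B), 1 - \<alpha>}"
    by (simp add: \<rho> lead_rate_def p_def b_def B_def A_def)
  show "(1 - p) / (1 - b) \<le> \<rho>" "1 - \<gamma> / (2 * lambda_max B) \<le> \<rho>" "1 - \<alpha> \<le> \<rho>"
    unfolding r by (auto intro: Max_ge)
  show "\<rho> \<le> 1"
    unfolding r using b_bounds positive lambda_max_B by simp
  show "\<rho> < 1" if "0 < \<alpha>" "b < p"
    unfolding r using b_bounds positive lambda_max_B that by simp
qed

section \<open>The descent inequality, along a path and in expectation\<close>

lemma average_gradients: "average_matrix ** Gs = 0"
proof -
  have "(\<Sum>i\<in>UNIV. g i xstar) = 0"
    using sum_gradients_at_minimizer[OF f _ xstar] \<mu> by simp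
  hence "(average_matrix ** Gs) $ i = 0" for i
    by (simp add: average_matrix_mult_nth Gs_def grad_matrix_def Xs_def consensus_def)
  thus ?thesis by (subst vec_eq_iff) simp
qed

text \<open>\<open>D 1\<close> and all increments have \<open>A\<close> as left factor, and
  \<open>J A = 0\<close>.\<close>

lemma average_D:
  assumes "w \<in> space M" "1 \<le> k"
  shows "average_matrix ** D k w = 0"
  using assms(2)
proof (induction k rule: dec_induct)
  case base
  show ?case unfolding initial(2)[OF assms(1)] by (simp add: matrix_mul_assoc average_A)
next
  case (step k)
  thus ?case unfolding iterate(2)[OF assms(1) step(1)]
    by (simp add: matrix_add_ldistrib matrix_mult_scaleR matrix_mul_assoc average_A)
qed

lemma B_A_orthogonal:
  fixes U V :: "real^'d^'n"
  assumes "average_matrix ** V = 0"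
  shows "V \<bullet> (B ** (A ** U)) = V \<bullet> U"
proof -
  have "V \<bullet> (average_matrix ** U) = 0"
    using symmetric_matrix_inner_matrix[OF transpose_average_matrix, of V U] assms by simp
  thus ?thesis by (simp add: matrix_mul_assoc B_A matrix_mult_diff_left inner_diff_right)
qed

lemma lyapunov_eq:
  "Lyap k w = (1 - b) * (norm (X k w - Xs))\<^sup>2
     + 2 * \<eta>\<^sup>2 / \<gamma> * ((D k w + Gs) \<bullet> (B ** (D k w + Gs))) + a1 * (norm (H k w - Xs))\<^sup>2"
  by (simp add: Lyap_def lead_lyapunov_def b_def weighted_norm_sq_eq_inner B_def A_def)

text \<open>The error after a gradient step without noise. It is determined by the past, so its
  inner product with the gradient noise has mean zero.\<close>

definition "R k w = X k w - Xs - \<eta> *\<^sub>R (grad_matrix g (X k w) - Gs)"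

lemma gradient_step_le: "(norm (R k w))\<^sup>2 \<le> (1 - p) * (norm (X k w - Xs))\<^sup>2"
proof -
  have nsq: "(norm V)\<^sup>2 = (\<Sum>i\<in>UNIV. (norm (V $ i))\<^sup>2)" for V :: "real^'d^'n"
    by (simp add: power2_norm_eq_inner inner_vec_def)
  have "(norm (R k w $ i))\<^sup>2 \<le> (1 - p) * (norm ((X k w - Xs) $ i))\<^sup>2" for i
    unfolding R_def Gs_def p_def using gradient_step_contraction[OF f \<mu>, where \<eta> = \<eta> and i1 = i and x = "X k w $ i" and y = "Xs $ i"] \<eta>
    by (simp add: grad_matrix_def)
  thus ?thesis unfolding nsq sum_distrib_left by (intro sum_mono)
qed

(* The coefficient of the compression error in the last term of lead_descent. *)
definition "S k w = (1 - b) *\<^sub>R ((\<gamma>\<^sup>2 / 2) *\<^sub>R (A ** (A ** (Y k w - Xs))) - \<gamma> *\<^sub>R (A ** (Y k w - Xs)))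
  + (2 * \<eta>) *\<^sub>R (D k w + Gs) + \<gamma> *\<^sub>R (A ** (Y k w - Xs))
  + (2 * a1 * \<alpha>) *\<^sub>R ((1 - \<alpha>) *\<^sub>R (H k w - Xs) + \<alpha> *\<^sub>R (Y k w - Xs))"

text \<open>\<open>lead_descent\<close> is applied to the deviations from the optimum; the shift by
  \<open>Xs\<close> is invisible to \<open>A\<close>, which annihilates consensus matrices. Each of
  the three Lyapunov terms is matched with one entry of the maximum that defines
  \<open>\<rho>\<close>.\<close>

lemma pathwise_descent:
  assumes w: "w \<in> space M" and k: "1 \<le> k"
  shows "Lyap (Suc k) w \<le> \<rho> * Lyap k w + \<eta>\<^sup>2 * (norm (N k w))\<^sup>2 - 2 * \<eta> * (R k w \<bullet> N k w)
    + \<kappa> * (norm (E k w))\<^sup>2 - a1 * \<alpha> * (1 - \<alpha>) * (norm (Y k w - H k w))\<^sup>2 + S k w \<bullet> E k w"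
proof -
  define x y h d e where "x = X k w - Xs" and "y = Y k w - Xs" and "h = H k w - Xs"
    and "d = D k w + Gs" and "e = E k w"
  define v where "v = R k w - \<eta> *\<^sub>R N k w"
  have AXs: "A ** (V + Xs) = A ** V" for V :: "real^'d^'n"
    by (simp add: matrix_add_ldistrib Xs_def A_consensus)
  have Ye: "Y k w + E k w = y + e + Xs" by (simp add: y_def e_def)
  have d': "D (Suc k) w + Gs = d + (\<gamma> / (2 * \<eta>)) *\<^sub>R (A ** (y + e))"
    unfolding iterate(2)[OF w k] Ye AXs by (simp add: d_def)
  have x': "X (Suc k) w - Xs = y - (\<gamma> / 2) *\<^sub>R (A ** (y + e))"
    unfolding iterate(3)[OF w k] iterate(2)[OF w k] Ye AXs
    using positive by (simp add: y_def scaleR_add_right)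
  have h': "H (Suc k) w - Xs = (1 - \<alpha>) *\<^sub>R h + \<alpha> *\<^sub>R (y + e)"
    unfolding iterate(1)[OF w k] Ye by (simp add: h_def algebra_simps)
  \<comment> \<open>The multiple of \<open>Gs\<close> contained in \<open>R\<close> cancels the one
    contained in \<open>d\<close>.\<close>
  have yv: "y = v - \<eta> *\<^sub>R d"
    by (simp add: y_def v_def d_def R_def N_def grad_noise_def Y_def algebra_simps)
  have davg: "average_matrix ** d = 0"
    using average_D[OF w k] average_gradients by (simp add: d_def matrix_add_ldistrib)
  have ABA: "A ** (B ** (A ** U)) = A ** U" for U :: "real^'d^'n"
    by (simp add: matrix_mul_assoc A_B matrix_mult_diff_left average_A)
  have lin: "linear (\<lambda>U::real^'d^'n. P ** U)" for P
    by (rule bounded_linear.linear) (rule bounded_linear_matrix_mult)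
  have "Lyap (Suc k) w \<le> (norm v)\<^sup>2 + (1 - \<gamma> / (2 * lambda_max B)) * (2 * \<eta>\<^sup>2 / \<gamma> * (d \<bullet> (B ** d)))
       + (1 - \<alpha>) * (a1 * (norm h)\<^sup>2) + \<kappa> * (norm e)\<^sup>2
       - a1 * \<alpha> * (1 - \<alpha>) * (norm (y - h))\<^sup>2 + S k w \<bullet> e"
    unfolding lyapunov_eq x' d' h' \<kappa>_def S_def y_def[symmetric] h_def[symmetric] d_def[symmetric]
  proof (rule lead_descent[where T = "\<lambda>U. A ** U" and S = "\<lambda>U. B ** U"])
    show "u \<bullet> (A ** u) \<le> \<beta> * (norm u)\<^sup>2" "(norm (A ** u))\<^sup>2 \<le> \<beta> * (u \<bullet> (A ** u))" for u :: "real^'d^'n"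
      unfolding beta_eq using positive beta_eq by (auto intro: form_A_le norm_A_sq_le)
    show "u \<bullet> (A ** v) = (A ** u) \<bullet> v" "u \<bullet> (B ** v) = (B ** u) \<bullet> v" for u v :: "real^'d^'n"
      by (intro symmetric_matrix_inner_matrix sym_A sym_B)+
    show "d \<bullet> (B ** (A ** u)) = d \<bullet> u" for u by (rule B_A_orthogonal[OF davg])
    show "0 \<le> u \<bullet> (A ** u)" for u :: "real^'d^'n" by (rule psd_A_matrix)
    show "d \<bullet> (B ** d) \<le> lambda_max B * (norm d)\<^sup>2" by (rule form_B_le)
  qed (use positive t_bound b_bounds yv in \<open>simp_all add: lin ABA lambda_max_B b_def\<close>)
  moreover have "(norm v)\<^sup>2 \<le> \<rho> * ((1 - b) * (norm x)\<^sup>2) + \<eta>\<^sup>2 * (norm (N k w))\<^sup>2 - 2 * \<eta> * (R k w \<bullet> N k w)"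
  proof -
    have "(norm v)\<^sup>2 = (norm (R k w))\<^sup>2 + \<eta>\<^sup>2 * (norm (N k w))\<^sup>2 - 2 * \<eta> * (R k w \<bullet> N k w)"
      unfolding v_def power2_norm_eq_inner
      by (simp add: inner_diff_left inner_diff_right inner_commute power2_eq_square algebra_simps)
    moreover have "(norm (R k w))\<^sup>2 \<le> (1 - p) * (norm x)\<^sup>2" unfolding x_def by (rule gradient_step_le)
    \<comment> \<open>\<open>(norm v)\<^sup>2\<close> comes without the weight \<open>1 - b\<close>
      of the primal term; restoring it puts \<open>1 - b\<close> into the denominator of the first
      entry of the rate.\<close>
    moreover have "1 - p \<le> \<rho> * (1 - b)" using rate_ge(1) b_bounds by (simp add: pos_divide_le_eq)
    hence "(1 - p) * (norm x)\<^sup>2 \<le> \<rho> * (1 - b) * (norm x)\<^sup>2" by (rule mult_right_mono) simp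
    ultimately show ?thesis by (simp add: mult.assoc)
  qed
  moreover have "(1 - \<gamma> / (2 * lambda_max B)) * (2 * \<eta>\<^sup>2 / \<gamma> * (d \<bullet> (B ** d))) \<le> \<rho> * (2 * \<eta>\<^sup>2 / \<gamma> * (d \<bullet> (B ** d)))"
    using rate_ge(2) positive psd_B_matrix[of d] by (intro mult_right_mono) auto
  moreover have "(1 - \<alpha>) * (a1 * (norm h)\<^sup>2) \<le> \<rho> * (a1 * (norm h)\<^sup>2)"
    using rate_ge(3) positive by (intro mult_right_mono) auto
  moreover have "Lyap k w = (1 - b) * (norm x)\<^sup>2 + 2 * \<eta>\<^sup>2 / \<gamma> * (d \<bullet> (B ** d)) + a1 * (norm h)\<^sup>2"
    by (simp add: lyapunov_eq x_def d_def h_def)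
  hence "\<rho> * Lyap k w = \<rho> * ((1 - b) * (norm x)\<^sup>2) + \<rho> * (2 * \<eta>\<^sup>2 / \<gamma> * (d \<bullet> (B ** d))) + \<rho> * (a1 * (norm h)\<^sup>2)"
    by (simp only: distrib_left)
  moreover have "y - h = Y k w - H k w" by (simp add: y_def h_def)
  ultimately show ?thesis unfolding e_def by simp
qed

lemma integrable_Lyap:
  assumes "1 \<le> k"
  shows "integrable M (Lyap k)"
proof -
  have ad: "adapted (past k) (X k)" "adapted (past k) (H k)" "adapted (past k) (D k)"
    using adapted_iterates[OF assms] by auto
  have "adapted (past k) (\<lambda>w. X k w - Xs)" "adapted (past k) (\<lambda>w. H k w - Xs)"
    "adapted (past k) (\<lambda>w. D k w + Gs)" "adapted (past k) (\<lambda>w. B ** (D k w + Gs))"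
    by (intro adapted_intros ad)+
  hence "square_integrable (\<lambda>w. X k w - Xs)" "square_integrable (\<lambda>w. H k w - Xs)"
    "integrable M (\<lambda>w. (D k w + Gs) \<bullet> (B ** (D k w + Gs)))"
    by (auto simp: adapted_def intro: square_integrable_inner)
  thus ?thesis unfolding lyapunov_eq[abs_def]
    by (intro Bochner_Integration.integrable_add Bochner_Integration.integrable_mult_right)
      (simp_all add: square_integrable_def)
qed

text \<open>\<open>R\<close> uses only noise before iteration \<open>k\<close>, while
  \<open>S\<close> contains the current gradient noise through \<open>Y\<close>. So the gradient
  noise is tested against \<open>past k\<close>, and the compression noise against
  \<open>past k\<close> enlarged by \<open>Inl k\<close>.\<close>

lemma expected_descent:
  assumes k: "1 \<le> k"
  shows "expectation (Lyap (Suc k)) \<le> \<rho> * expectation (Lyap k) + \<eta>\<^sup>2 * (\<Sum>i\<in>UNIV. (\<sigma> i)\<^sup>2)"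
proof -
  have ad: "adapted (past k) (X k)" "adapted (past k) (H k)" "adapted (past k) (D k)"
    using adapted_iterates[OF k] by auto
  let ?J = "insert (Inl k) (past k)"
  have m: "adapted (past k) V \<Longrightarrow> adapted ?J V" for V by (erule adapted_mono) auto
  have Y: "adapted ?J (Y k)" by (rule adapted_Y[OF ad(1,3)])
  have YH: "adapted ?J (\<lambda>w. Y k w - H k w)" by (intro adapted_intros Y m[OF ad(2)])
  have R: "adapted (past k) (R k)"
    unfolding R_def[abs_def] by (intro adapted_intros adapted_grad_matrix ad)
  have S: "adapted ?J (S k)"
    unfolding S_def[abs_def] by (intro adapted_intros Y m[OF ad(2)] m[OF ad(3)])
  have N: "adapted ?J (N k)" unfolding N_def by (rule adapted_grad_noise[OF ad(1) past_simps(1,2)])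
  have E: "adapted (past (Suc k)) (E k)" using k ad by (rule adapted_E)
  have sq: "square_integrable V" if "adapted J V" for J V using that by (simp add: adapted_def)
  have i: "integrable M (\<lambda>w. (norm (V w))\<^sup>2)" if "adapted J V" for J V
    using sq[OF that] by (simp add: square_integrable_def)
  note int = integrable_Lyap[OF k] i[OF N] i[OF E] i[OF YH] square_integrable_inner[OF sq[OF R] sq[OF N]]
    square_integrable_inner[OF sq[OF S] sq[OF E]]
  have "expectation (Lyap (Suc k)) \<le> expectation (\<lambda>w. \<rho> * Lyap k w + \<eta>\<^sup>2 * (norm (N k w))\<^sup>2 - 2 * \<eta> * (R k w \<bullet> N k w)
    + \<kappa> * (norm (E k w))\<^sup>2 - a1 * \<alpha> * (1 - \<alpha>) * (norm (Y k w - H k w))\<^sup>2 + S k w \<bullet> E k w)"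
    using k int by (intro Bochner_Integration.integral_mono pathwise_descent integrable_Lyap) auto
  also have "\<dots> = \<rho> * expectation (Lyap k) + \<eta>\<^sup>2 * expectation (\<lambda>w. (norm (N k w))\<^sup>2)
    - 2 * \<eta> * expectation (\<lambda>w. R k w \<bullet> N k w) + \<kappa> * expectation (\<lambda>w. (norm (E k w))\<^sup>2)
    - a1 * \<alpha> * (1 - \<alpha>) * expectation (\<lambda>w. (norm (Y k w - H k w))\<^sup>2) + expectation (\<lambda>w. S k w \<bullet> E k w)"
    using int by simp
  also have "expectation (\<lambda>w. R k w \<bullet> N k w) = 0"
    unfolding N_def by (rule grad_noise_centred[OF ad(1) past_simps(1,2) R])
  also have "expectation (\<lambda>w. S k w \<bullet> E k w) = 0"
    unfolding E_def by (rule compress_noise_centred[OF YH past_simps(5)[OF k] past_simps(3) k S])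
  finally have "expectation (Lyap (Suc k)) \<le> \<rho> * expectation (Lyap k)
      + \<eta>\<^sup>2 * expectation (\<lambda>w. (norm (N k w))\<^sup>2) + \<kappa> * expectation (\<lambda>w. (norm (E k w))\<^sup>2)
      - a1 * \<alpha> * (1 - \<alpha>) * expectation (\<lambda>w. (norm (Y k w - H k w))\<^sup>2)" by simp
  moreover have "\<eta>\<^sup>2 * expectation (\<lambda>w. (norm (N k w))\<^sup>2) \<le> \<eta>\<^sup>2 * (\<Sum>i\<in>UNIV. (\<sigma> i)\<^sup>2)"
    unfolding N_def by (intro mult_left_mono grad_noise_second_moment[OF ad(1) past_simps(1,2)]) simp
  moreover have "\<kappa> * expectation (\<lambda>w. (norm (E k w))\<^sup>2)
      \<le> \<kappa> * (C * expectation (\<lambda>w. (norm (Y k w - H k w))\<^sup>2))"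
    unfolding E_def
    by (intro mult_left_mono compress_noise_second_moment[OF YH past_simps(5)[OF k] past_simps(3) k] kappa_nonneg)
  moreover have "C * \<kappa> * expectation (\<lambda>w. (norm (Y k w - H k w))\<^sup>2)
      \<le> a1 * \<alpha> * (1 - \<alpha>) * expectation (\<lambda>w. (norm (Y k w - H k w))\<^sup>2)"
    by (intro mult_right_mono kappa_le Bochner_Integration.integral_nonneg) simp
  ultimately show ?thesis by (simp add: mult_ac)
qed

end

text \<open>Integrability is part of the claim because the integral of a non-integrable function is
  0, which would empty the inequality of content. Strict contraction is conditional: the rate equals
  1 at \<open>\<alpha> = 0\<close>, which the constraints admit only for \<open>C = 0\<close>, and
  at \<open>a1 * \<alpha> = \<mu> * \<eta> * (2 - \<mu> * \<eta>)\<close>.\<close>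

theorem theorem1:
  fixes M :: "'w measure" and PX :: "'n::finite \<Rightarrow> 'x measure" and PS :: "'s measure"
    and \<xi> :: "nat \<Rightarrow> 'w \<Rightarrow> 'n \<Rightarrow> 'x" and \<zeta> :: "nat \<Rightarrow> 'w \<Rightarrow> 'n \<Rightarrow> 's"
    and Adj :: "'n \<Rightarrow> 'n \<Rightarrow> bool" and W :: "real^'n^'n"
    and f :: "'n \<Rightarrow> real^'d::finite \<Rightarrow> real" and g :: "'n \<Rightarrow> real^'d \<Rightarrow> real^'d"
    and G :: "'n \<Rightarrow> real^'d \<Rightarrow> 'x \<Rightarrow> real^'d" and Q :: "real^'d \<Rightarrow> 's \<Rightarrow> real^'d"
    and \<sigma> :: "'n \<Rightarrow> real" and xstar :: "real^'d"
    and X0 H1 Z :: "real^'d^'n" and X H D :: "nat \<Rightarrow> 'w \<Rightarrow> real^'d^'n"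
    and L \<mu> \<eta> \<alpha> \<gamma> \<beta> C a1 \<rho> \<sigma>sq :: real
  assumes "prob_space M"
    and "connected_graph Adj" and "mixing_matrix Adj W"
    and "C \<ge> 0" and "unbiased_contracted C PS Q"
    and "\<And>i. unbiased_stoch_grad (PX i) (G i) (g i) (\<sigma> i)"
    and "\<sigma>sq = (1 / real CARD('n)) * (\<Sum>i\<in>UNIV. (\<sigma> i)\<^sup>2)"
    and "fresh_noise M PX PS \<xi> \<zeta>"
    and "\<mu> > 0" and "L \<ge> \<mu>" and "\<And>i. smooth_strongly_convex \<mu> L (f i) (g i)"
    and "\<And>x. (1 / real CARD('n)) * (\<Sum>i\<in>UNIV. f i xstar) \<le> (1 / real CARD('n)) * (\<Sum>i\<in>UNIV. f i x)"
    and "\<And>\<omega>. \<omega> \<in> space M \<Longrightarrow>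
           lead_path W \<eta> \<alpha> \<gamma>
             (\<lambda>k A. stoch_grad_matrix G A (\<xi> k \<omega>)) (\<lambda>k A. compress Q A (\<zeta> k \<omega>))
             X0 H1 Z (\<lambda>k. X k \<omega>) (\<lambda>k. H k \<omega>) (\<lambda>k. D k \<omega>)"
    and "\<beta> = lambda_max (mat 1 - W)"
    and "a1 = 4 * (1 + C) / (C * \<beta> * \<gamma> + 2)"
    and "\<rho> = lead_rate W \<mu> \<eta> \<alpha> \<gamma> a1"
    and "\<eta> \<in> {0<..2 / (\<mu> + L)}"
    and "\<gamma> \<in> {0<..<gamma_bound C \<beta> \<mu> \<eta>}"
    and "\<alpha> \<in> {C * \<beta> * \<gamma> / (2 * (1 + C)) ..
               1 / a1 * min ((2 - \<beta> * \<gamma>) / (4 - \<beta> * \<gamma>)) (\<mu> * \<eta> * (2 - \<mu> * \<eta>))}"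
  shows
    "let Xstar = consensus xstar; Dstar = - grad_matrix g Xstar;
         Lyap = (\<lambda>k \<omega>. lead_lyapunov W \<eta> \<alpha> \<gamma> a1 Xstar Dstar (X k \<omega>) (H k \<omega>) (D k \<omega>))
     in (\<forall>k\<ge>1. integrable M (Lyap k) \<and>
           (1 / real CARD('n)) * (LINT \<omega>|M. Lyap (Suc k) \<omega>)
             \<le> \<rho> * ((1 / real CARD('n)) * (LINT \<omega>|M. Lyap k \<omega>)) + \<eta>\<^sup>2 * \<sigma>sq) \<and>
        \<rho> \<le> 1 \<and> (0 < \<alpha> \<and> a1 * \<alpha> < \<mu> * \<eta> * (2 - \<mu> * \<eta>) \<longrightarrow> \<rho> < 1)"
proof -
  interpret lead M Adj W PX PS \<xi> \<zeta> f g G Q \<sigma> xstar X0 H1 Z X H D L \<mu> \<eta> \<alpha> \<gamma> \<beta> C a1 \<rho>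
  proof (intro lead.intro mixing.intro lead_axioms.intro)
    show "(\<Sum>i\<in>UNIV. f i xstar) \<le> (\<Sum>i\<in>UNIV. f i x)" for x
      using assms(12)[of x] by (simp add: divide_le_cancel)
  qed (fact assms)+
  have "(1 / real CARD('n)) * expectation (Lyap (Suc k))
      \<le> \<rho> * ((1 / real CARD('n)) * expectation (Lyap k)) + \<eta>\<^sup>2 * \<sigma>sq" if k: "1 \<le> k" for k
  proof -
    have "(1 / real CARD('n)) * expectation (Lyap (Suc k))
        \<le> (1 / real CARD('n)) * (\<rho> * expectation (Lyap k) + \<eta>\<^sup>2 * (\<Sum>i\<in>UNIV. (\<sigma> i)\<^sup>2))"
      by (intro mult_left_mono expected_descent k) simp
    thus ?thesis unfolding assms(7) by (simp add: field_simps)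
  qed
  thus ?thesis
    using integrable_Lyap rate_le rate_less
    unfolding Let_def Lyap_def[abs_def] Xs_def Gs_def b_def p_def by auto
qed

end
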